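(* Consider the grouped linear model $Y=X\beta+\varepsilon$ satisfying the narrow-sense sparsity condition $\|\beta_k\|_2=0$ for $k\in A_0=\{q+1,\dots,p\}$. Let $\tilde\beta$ be an initial estimator and let $\hat\beta^*$ be the adaptive group Lasso estimator with penalty parameter $\tilde\lambda$ and initial estimator $\tilde\beta$. Suppose that: (C1) the errors $\varepsilon_1,\dots,\varepsilon_n$ are i.i.d. $N(0,\sigma^2)$; (C2) $\tilde\beta$ is consistent at zero with rate $r_n\to\infty$; (C3) as $n\to\infty$, $$\frac{\sqrt{d_a\log q}}{\sqrt n\,\theta_b}\to0,\qquad \frac{\tilde\lambda d_a^{3/2}q}{n\theta_b^2}\to0,\qquad \frac{\sqrt{nd\log(p-q)}}{\tilde\lambda r_n}\to0,\qquad \frac{d_a^{5/2}q^2}{r_n\theta_b\sqrt{d_b}}\to0;$$ (C4) all of the eigenvalues of $\Sigma_{A_0^cA_0^c}$ are bounded away from zero and infinity. Then $$P\big(\|\hat\beta_k^*\|_2\ne0 \text{ for all } k\notin A_0,\ \ \|\hat\beta_k^*\|_2=0 \text{ for all } k\in A_0\big)\to1 .$$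
   Context: Model: there are $p$ groups; $X=(X_1,\dots,X_p)$ where $X_k$ is an $n\times d_k$ (non-random) covariate matrix, $\beta=(\beta_1',\dots,\beta_p')'$ with $\beta_k\in\mathbb R^{d_k}$, $\varepsilon=(\varepsilon_1,\dots,\varepsilon_n)'$, $Y=X\beta+\varepsilon\in\mathbb R^n$. All quantities may depend on $n$, and limits are as $n\to\infty$. Notation: $A_0=\{q+1,\dots,p\}$, $A_0^c=\{1,\dots,q\}$; $d_a=\max_kd_k$, $d_b=\min_kd_k$, $d=d_a/d_b$; $\theta_b=\min_{k\in A_0^c}\|\beta_k\|_2$; for $A\subset\{1,\dots,p\}$, $X_A=(X_k,k\in A)$ and $\Sigma_{AA}=X_A'X_A/n$. Consistency at zero: an initial estimator $\tilde\beta=(\tilde\beta_1',\dots,\tilde\beta_p')'$ is consistent at zero with rate $r_n$ if $r_n\max_{k\in A_0}\|\tilde\beta_k\|_2=O_p(1)$, where $r_n\to\infty$ as $n\to\infty$, and there exists a constant $\xi_b>0$ such that for any $\epsilon>0$, $P(\min_{k\in A_0^c}\|\tilde\beta_k\|_2>\xi_b\theta_b)>1-\epsilon$ for $n$ sufficiently large. Adaptive group Lasso: $$\hat\beta^*=\arg\min_\beta\tfrac12(Y-X\beta)'(Y-X\beta)+\tilde\lambda\sum_{k=1}^p\|\tilde\beta_k\|_2^{-1}\sqrt{d_k}\,\|\beta_k\|_2,$$ with the convention that if $\|\tilde\beta_k\|_2=0$ the weight is $+\infty$ and $\hat\beta_k^*=0$.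
   Formalization: Two hypotheses are added, without which the claim fails: the columns of all the X_k have squared norm at most Cn for one constant C, and p − q ≥ 2, so that log(p − q) > 0 and the third condition of (C3) has content. *)

theory Defs
  imports "HOL-Probability.Probability" "Jordan_Normal_Form.Char_Poly"
begin

(* Vectors and matrices are those of Jordan_Normal_Form, because all dimensions vary with the
   sample size.  Matrix rows and vector entries are indexed from 0, groups from 1 to p.
   A grouped coefficient vector (b_1', ..., b_p')' is a function from group indices to vectors. *)

definition l2 :: "real Matrix.vec \<Rightarrow> real" where
  "l2 v = sqrt (Matrix.scalar_prod v v)"

(* X_A = (X_k, k in A), the blocks side by side in increasing order of k *)
definition block_cols :: "nat \<Rightarrow> (nat \<Rightarrow> real mat) \<Rightarrow> nat set \<Rightarrow> real mat" where
  "block_cols n X A = mat_of_cols n (concat (map (\<lambda>k. cols (X k)) (sorted_list_of_set A)))"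

definition stack :: "nat \<Rightarrow> (nat \<Rightarrow> real Matrix.vec) \<Rightarrow> real Matrix.vec" where
  "stack p b = vec_of_list (concat (map (\<lambda>k. list_of_vec (b k)) (sorted_list_of_set {1..p})))"

definition lin_pred :: "nat \<Rightarrow> nat \<Rightarrow> (nat \<Rightarrow> real mat) \<Rightarrow> (nat \<Rightarrow> real Matrix.vec) \<Rightarrow> real Matrix.vec" where
  "lin_pred n p X b = block_cols n X {1..p} *\<^sub>v stack p b"

definition Sigma_mat :: "nat \<Rightarrow> (nat \<Rightarrow> real mat) \<Rightarrow> nat set \<Rightarrow> real mat" where
  "Sigma_mat n X A =
     (1 / real n) \<cdot>\<^sub>m (transpose_mat (block_cols n X A) * block_cols n X A)"

definition response ::
  "nat \<Rightarrow> nat \<Rightarrow> (nat \<Rightarrow> real mat) \<Rightarrow> (nat \<Rightarrow> real Matrix.vec) \<Rightarrow> (nat \<Rightarrow> real) \<Rightarrow> real Matrix.vec" where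
  "response n p X \<beta> e = lin_pred n p X \<beta> + Matrix.vec n e"

definition d_max :: "nat \<Rightarrow> (nat \<Rightarrow> nat) \<Rightarrow> nat" where
  "d_max p d = Max (d ` {1..p})"

definition d_min :: "nat \<Rightarrow> (nat \<Rightarrow> nat) \<Rightarrow> nat" where
  "d_min p d = Min (d ` {1..p})"

definition d_ratio :: "nat \<Rightarrow> (nat \<Rightarrow> nat) \<Rightarrow> real" where
  "d_ratio p d = real (d_max p d) / real (d_min p d)"

definition theta_min :: "nat \<Rightarrow> (nat \<Rightarrow> real Matrix.vec) \<Rightarrow> real" where
  "theta_min q \<beta> = Min ((\<lambda>k. l2 (\<beta> k)) ` {1..q})"

(* Extended-real valued: inverse 0 = \<infinity> in ereal, so a group with vanishing initial estimate has
   weight \<infinity>; \<infinity> * 0 = 0 in ereal, so such a group costs nothing exactly when it is set to zero. *)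
definition agl_objective ::
  "nat \<Rightarrow> nat \<Rightarrow> (nat \<Rightarrow> nat) \<Rightarrow> (nat \<Rightarrow> real mat) \<Rightarrow> real Matrix.vec \<Rightarrow> real
     \<Rightarrow> (nat \<Rightarrow> real Matrix.vec) \<Rightarrow> (nat \<Rightarrow> real Matrix.vec) \<Rightarrow> ereal" where
  "agl_objective n p d X y lam bt b =
     ereal (1/2 * Matrix.scalar_prod (y - lin_pred n p X b) (y - lin_pred n p X b))
     + ereal lam * (\<Sum>k\<in>{1..p}. inverse (ereal (l2 (bt k))) * ereal (sqrt (real (d k)) * l2 (b k)))"

definition is_adaptive_group_lasso ::
  "nat \<Rightarrow> nat \<Rightarrow> (nat \<Rightarrow> nat) \<Rightarrow> (nat \<Rightarrow> real mat) \<Rightarrow> real Matrix.vec \<Rightarrow> real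
     \<Rightarrow> (nat \<Rightarrow> real Matrix.vec) \<Rightarrow> (nat \<Rightarrow> real Matrix.vec) \<Rightarrow> bool" where
  "is_adaptive_group_lasso n p d X y lam bt bh \<longleftrightarrow>
     (\<forall>k\<in>{1..p}. bh k \<in> carrier_vec (d k)) \<and>
     (\<forall>k\<in>{1..p}. l2 (bt k) = 0 \<longrightarrow> bh k = 0\<^sub>v (d k)) \<and>
     (\<forall>b. (\<forall>k\<in>{1..p}. b k \<in> carrier_vec (d k)) \<longrightarrow>
        agl_objective n p d X y lam bt bh \<le> agl_objective n p d X y lam bt b)"

definition random_groups ::
  "'a measure \<Rightarrow> nat \<Rightarrow> (nat \<Rightarrow> nat) \<Rightarrow> ('a \<Rightarrow> nat \<Rightarrow> real Matrix.vec) \<Rightarrow> bool" where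
  "random_groups M p d b \<longleftrightarrow>
     (\<forall>k\<in>{1..p}. (\<forall>\<omega>\<in>space M. b \<omega> k \<in> carrier_vec (d k)) \<and>
        (\<forall>j<d k. (\<lambda>\<omega>. vec_index (b \<omega> k) j) \<in> borel_measurable M))"

(* Z_n = O_p(1), the n-th variable living on its own probability space *)
definition bounded_in_prob :: "(nat \<Rightarrow> 'a measure) \<Rightarrow> (nat \<Rightarrow> 'a \<Rightarrow> real) \<Rightarrow> bool" where
  "bounded_in_prob M Z \<longleftrightarrow>
     (\<forall>\<epsilon>>0. \<exists>K. \<forall>\<^sub>F n in sequentially.
        Sigma_Algebra.measure (M n) {\<omega>\<in>space (M n). \<bar>Z n \<omega>\<bar> > K} < \<epsilon>)"

definition consistent_at_zero ::
  "(nat \<Rightarrow> 'a measure) \<Rightarrow> (nat \<Rightarrow> nat) \<Rightarrow> (nat \<Rightarrow> nat) \<Rightarrow> (nat \<Rightarrow> nat \<Rightarrow> real Matrix.vec)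
     \<Rightarrow> (nat \<Rightarrow> 'a \<Rightarrow> nat \<Rightarrow> real Matrix.vec) \<Rightarrow> (nat \<Rightarrow> real) \<Rightarrow> bool" where
  "consistent_at_zero M p q \<beta> bt r \<longleftrightarrow>
     filterlim r at_top sequentially \<and>
     bounded_in_prob M (\<lambda>n \<omega>. r n * Max ((\<lambda>k. l2 (bt n \<omega> k)) ` {q n + 1..p n})) \<and>
     (\<exists>\<xi>>0. \<forall>\<epsilon>>0. \<forall>\<^sub>F n in sequentially.
        Sigma_Algebra.measure (M n)
          {\<omega>\<in>space (M n). Min ((\<lambda>k. l2 (bt n \<omega> k)) ` {1..q n}) > \<xi> * theta_min (q n) (\<beta> n)}
        > 1 - \<epsilon>)"

end

theory Submission
  imports Defs
begin

text \<open>Write \<open>S\<close> for the signal groups \<open>1..q\<close>, \<open>A\<close> for the null groups \<open>q+1..p\<close>, and \<open>w_k = lam * sqrt d_k / |bt_k|\<close> for the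
weight of group \<open>k\<close> in the penalty, with \<open>bt\<close> the initial estimate; \<open>c > 0\<close> bounds the eigenvalues from below.  Consistency at zero makes the weights on \<open>S\<close> at most \<open>m = lam * sqrt da / (\<xi> * \<theta>)\<close> and
those on \<open>A\<close> at least \<open>lam * sqrt d_k * r / K\<close>, up to small probability.  Two consequences of the
minimality of the estimate \<open>h\<close>, each obtained by testing it against one well chosen perturbation, separate the
deterministic part of the proof from the probabilistic one.

Null groups (\<open>null_groups_vanish\<close>).  Regress every null column on the signal columns.  Removing the null groups
from \<open>h\<close>, and adding on \<open>S\<close> the coefficients that reproduce their projection, changes the fit by the residual part
\<open>\<rho>\<close> only, which is orthogonal to all signal columns.  The residual sum of squares cannot lose more than the correlation of
the noise with \<open>\<rho>\<close>, and the penalty on \<open>S\<close> grows by at most \<open>m\<close> times the size of the added coefficients.  Both are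
at most a multiple of the norms of the removed groups; when every weight on \<open>A\<close> exceeds that multiple, minimality
forces the removed groups to be zero.

Signal groups (\<open>vanishing_group_noise\<close>).  If the null groups vanish and a signal group \<open>k\<close> were estimated by zero, then the
perturbation that solves the normal equations with right-hand side \<open>\<beta>_k / |\<beta>_k|\<close> shows that one centred Gaussian variable,
of standard deviation between constant multiples of \<open>1 / sqrt (n * d_k)\<close> and \<open>1 / sqrt n\<close>, is within
\<open>m * sqrt q / (n * c)\<close> of \<open>- |\<beta>_k|\<close>.  This distance is a vanishing fraction of \<open>\<theta>\<close>.

The bad events are therefore large values of Gaussian forms for the null columns, and near coincidences of a Gaussian
form with \<open>- |\<beta>_k|\<close> for the signal groups.  The former are summed over the \<open>p - q\<close> null groups by a tail bound
(\<open>Gaussian_group_tail\<close>), which costs the factor \<open>ln (p - q)\<close>.  The latter are summed over the \<open>q\<close> signal groups by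
the same bound when \<open>q \<ge> 2\<close>.  When \<open>q = 1\<close>, \<open>ln q = 0\<close> and the signal may lie below the noise level; then the boundedness of the Gaussian density (\<open>Gaussian_anticoncentration\<close>) still makes the coincidence
unlikely.

The hypothesis on the eigenvalues enters as \<open>n * c * |b|^2 \<le> |X_S b|^2\<close>, which needs that the smallest value of the Rayleigh
quotient of a symmetric matrix is an eigenvalue (\<open>symmetric_eigenvalue_Rayleigh\<close>).\<close>

unbundle no vec_syntax
unbundle no inner_syntax

section \<open>The smallest eigenvalue of a symmetric real matrix\<close>

lemma scalar_prod_self_nonneg: "0 \<le> (v :: real Matrix.vec) \<bullet> v"
  by (simp add: scalar_prod_def sum_nonneg)

lemma scalar_prod_self_eq_0:
  fixes v :: "real Matrix.vec"
  assumes "v \<in> carrier_vec n" "v \<bullet> v = 0"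
  shows "v = 0\<^sub>v n"
  using assms by (intro eq_vecI) (auto simp: scalar_prod_def sum_nonneg_eq_0_iff)

lemma scalar_prod_Cauchy_Schwarz:
  fixes u v :: "real Matrix.vec"
  assumes "u \<in> carrier_vec n" "v \<in> carrier_vec n"
  shows "(u \<bullet> v)\<^sup>2 \<le> (u \<bullet> u) * (v \<bullet> v)"
  using assms Cauchy_Schwarz_ineq_sum[of "vec_index u" "vec_index v" "{0..<n}"]
  by (simp add: scalar_prod_def power2_eq_square)

lemma mat_mult_vec_bounded:
  fixes A :: "real mat"
  assumes A: "A \<in> carrier_mat n m"
  obtains K where "K > 0" "\<And>x. x \<in> carrier_vec m \<Longrightarrow> (A *\<^sub>v x) \<bullet> (A *\<^sub>v x) \<le> K * (x \<bullet> x)"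
proof
  let ?K = "\<Sum>i<n. Matrix.row A i \<bullet> Matrix.row A i"
  show "1 + ?K > 0"
    by (intro add_pos_nonneg sum_nonneg scalar_prod_self_nonneg) simp
  fix x :: "real Matrix.vec" assume x: "x \<in> carrier_vec m"
  have "(A *\<^sub>v x) \<bullet> (A *\<^sub>v x) = (\<Sum>i<n. (Matrix.row A i \<bullet> x)\<^sup>2)"
    using A by (simp add: scalar_prod_def[of "A *\<^sub>v x"] power2_eq_square lessThan_atLeast0)
  also have "\<dots> \<le> (\<Sum>i<n. (Matrix.row A i \<bullet> Matrix.row A i) * (x \<bullet> x))"
    using A x by (intro sum_mono scalar_prod_Cauchy_Schwarz[of _ m]) auto
  also have "\<dots> \<le> (1 + ?K) * (x \<bullet> x)"
    using scalar_prod_self_nonneg[of x] by (simp add: sum_distrib_left algebra_simps)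
  finally show "(A *\<^sub>v x) \<bullet> (A *\<^sub>v x) \<le> (1 + ?K) * (x \<bullet> x)" .
qed

lemma smult_mat_mult_vec:
  fixes A :: "real mat"
  assumes "A \<in> carrier_mat n m" "x \<in> carrier_vec m"
  shows "(a \<cdot>\<^sub>m A) *\<^sub>v x = a \<cdot>\<^sub>v (A *\<^sub>v x)"
  using assms by (intro eq_vecI) auto

lemma transpose_smult_mat: "transpose_mat (a \<cdot>\<^sub>m A) = a \<cdot>\<^sub>m transpose_mat A"
  by (intro eq_matI) auto

text \<open>Invertibility bounds \<open>|x|\<close> by a multiple of \<open>|A x|\<close>, so it suffices to bound \<open>|A x|^2\<close> by a multiple of the quadratic form.
That follows from evaluating the nonnegative form at \<open>x - t * A x\<close> with \<open>t = 1 / (L + 1)\<close>, where \<open>L\<close> bounds the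
squared operator norm: the linear term in \<open>t\<close> is \<open>- 2 * t * |A x|^2\<close> and the quadratic term absorbs only half of it.\<close>

lemma psd_invertible_imp_coercive:
  fixes A :: "real mat"
  assumes A: "A \<in> carrier_mat m m" and sym: "transpose_mat A = A"
    and psd: "\<And>x. x \<in> carrier_vec m \<Longrightarrow> 0 \<le> x \<bullet> (A *\<^sub>v x)"
    and det: "Determinant.det A \<noteq> 0"
  obtains \<kappa> where "\<kappa> > 0" "\<And>x. x \<in> carrier_vec m \<Longrightarrow> \<kappa> * (x \<bullet> x) \<le> x \<bullet> (A *\<^sub>v x)"
proof -
  from det_non_zero_imp_unit[OF A det, of "()"] obtain B where
    B: "B \<in> carrier_mat m m" and BA: "B * A = 1\<^sub>m m"
    by (auto simp: Units_def ring_mat_def)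
  obtain K where K: "K > 0" "\<And>x. x \<in> carrier_vec m \<Longrightarrow> (B *\<^sub>v x) \<bullet> (B *\<^sub>v x) \<le> K * (x \<bullet> x)"
    using mat_mult_vec_bounded[OF B] by blast
  obtain L where L: "L > 0" "\<And>x. x \<in> carrier_vec m \<Longrightarrow> (A *\<^sub>v x) \<bullet> (A *\<^sub>v x) \<le> L * (x \<bullet> x)"
    using mat_mult_vec_bounded[OF A] by blast
  have A_norm: "((A *\<^sub>v x) \<bullet> (A *\<^sub>v x)) / (L + 1) \<le> x \<bullet> (A *\<^sub>v x)"
    if x: "x \<in> carrier_vec m" for x
  proof -
    define t where "t = 1 / (L + 1)"
    have t: "t > 0" "t * (L + 1) = 1" using L by (auto simp: t_def)
    let ?y = "A *\<^sub>v x" and ?z = "A *\<^sub>v (A *\<^sub>v x)"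
    have c: "?y \<in> carrier_vec m" "?z \<in> carrier_vec m" using A x by auto
    \<comment> \<open>Symmetry moves one factor \<open>A\<close> across the scalar product.\<close>
    have xz: "x \<bullet> ?z = ?y \<bullet> ?y"
      using transpose_vec_mult_scalar[OF A c(1) x] sym by simp
    have "0 \<le> (x + (-t) \<cdot>\<^sub>v ?y) \<bullet> (A *\<^sub>v (x + (-t) \<cdot>\<^sub>v ?y))"
      using A x by (intro psd) auto
    also have "A *\<^sub>v (x + (-t) \<cdot>\<^sub>v ?y) = ?y + (-t) \<cdot>\<^sub>v ?z"
      using A x c by (simp add: mult_add_distrib_mat_vec[OF A x] mult_mat_vec[OF A])
    also have "(x + (-t) \<cdot>\<^sub>v ?y) \<bullet> (?y + (-t) \<cdot>\<^sub>v ?z) =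
        x \<bullet> ?y - t * (?y \<bullet> ?y) - t * (?y \<bullet> ?y) + t * t * (?y \<bullet> ?z)"
      using x c A xz
      by (simp add: add_scalar_prod_distrib[of _ m] scalar_prod_add_distrib[of _ m] algebra_simps)
    finally have 1: "0 \<le> x \<bullet> ?y - 2 * (t * (?y \<bullet> ?y)) + t * t * (?y \<bullet> ?z)" by simp
    \<comment> \<open>The arithmetic-geometric mean inequality, weighted so that each term is at most \<open>(L + 1) * |y|^2\<close>.\<close>
    have "2 * (?y \<bullet> ?z) \<le> (L + 1) * (?y \<bullet> ?y) + (?z \<bullet> ?z) / (L + 1)"
    proof -
      have "0 \<le> ((L + 1) \<cdot>\<^sub>v ?y - ?z) \<bullet> ((L + 1) \<cdot>\<^sub>v ?y - ?z)"
        by (rule scalar_prod_self_nonneg)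
      also have "\<dots> = (L + 1) * ((L + 1) * (?y \<bullet> ?y) - 2 * (?y \<bullet> ?z)) + ?z \<bullet> ?z"
        using c A x comm_scalar_prod[OF c]
        by (simp add: minus_scalar_prod_distrib[of _ m] scalar_prod_minus_distrib[of _ m] algebra_simps)
      finally show ?thesis using L by (simp add: field_simps)
    qed
    moreover have "?z \<bullet> ?z / (L + 1) \<le> ?y \<bullet> ?y"
    proof -
      have "?z \<bullet> ?z \<le> L * (?y \<bullet> ?y)" by (rule L(2)[OF c(1)])
      also have "\<dots> \<le> (L + 1) * (?y \<bullet> ?y)" using scalar_prod_self_nonneg[of ?y] by (simp add: algebra_simps)
      finally show ?thesis using L by (simp add: field_simps)
    qed
    ultimately have "2 * (?y \<bullet> ?z) \<le> (L + 2) * (?y \<bullet> ?y)" by (simp add: algebra_simps)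
    also have "\<dots> \<le> 2 * ((L + 1) * (?y \<bullet> ?y))"
      using scalar_prod_self_nonneg[of ?y] L by (simp add: algebra_simps)
    finally have "t * t * (?y \<bullet> ?z) \<le> t * t * ((L + 1) * (?y \<bullet> ?y))"
      using t by (intro mult_left_mono) auto
    also have "\<dots> = t * (?y \<bullet> ?y)" using t by (metis (no_types, opaque_lifting) mult.assoc mult.commute mult.left_neutral)
    finally show ?thesis using 1 by (simp add: t_def)
  qed
  show thesis
  proof
    show "1 / (K * (L + 1)) > 0" using K L by simp
    fix x :: "real Matrix.vec" assume x: "x \<in> carrier_vec m"
    have "x = B *\<^sub>v (A *\<^sub>v x)"
      using assoc_mult_mat_vec[OF B A x] BA x by simp
    then have "x \<bullet> x \<le> K * ((A *\<^sub>v x) \<bullet> (A *\<^sub>v x))"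
      using K(2)[of "A *\<^sub>v x"] A x by simp
    also have "\<dots> \<le> K * ((L + 1) * (x \<bullet> (A *\<^sub>v x)))"
      using A_norm[OF x] K L by (intro mult_left_mono) (auto simp: field_simps)
    finally have "x \<bullet> x \<le> (x \<bullet> (A *\<^sub>v x)) * (K * (L + 1))" by (simp only: mult_ac)
    moreover have "0 < K * (L + 1)" using K L by simp
    ultimately show "1 / (K * (L + 1)) * (x \<bullet> x) \<le> x \<bullet> (A *\<^sub>v x)"
      by (simp add: pos_divide_le_eq)
  qed
qed

text \<open>The infimum \<open>\<mu>\<close> of the Rayleigh quotient is an eigenvalue: otherwise \<open>A - \<mu>\<close> is positive semidefinite and invertible, hence
coercive, and \<open>\<mu>\<close> could be increased.  This avoids both compactness of the sphere and diagonalisation.\<close>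

lemma symmetric_eigenvalue_Rayleigh:
  fixes A :: "real mat"
  assumes A: "A \<in> carrier_mat m m" and sym: "transpose_mat A = A" and m: "m > 0"
  obtains \<mu> where "eigenvalue A \<mu>" "\<And>x. x \<in> carrier_vec m \<Longrightarrow> \<mu> * (x \<bullet> x) \<le> x \<bullet> (A *\<^sub>v x)"
proof -
  define R where "R = (\<lambda>x. (x \<bullet> (A *\<^sub>v x)) / (x \<bullet> x)) ` (carrier_vec m - {0\<^sub>v m})"
  define \<mu> where "\<mu> = Inf R"
  obtain L where L: "L > 0" "\<And>x. x \<in> carrier_vec m \<Longrightarrow> (A *\<^sub>v x) \<bullet> (A *\<^sub>v x) \<le> L * (x \<bullet> x)"
    using mat_mult_vec_bounded[OF A] by blast
  have pos: "x \<bullet> x > 0" if "x \<in> carrier_vec m" "x \<noteq> 0\<^sub>v m" for x :: "real Matrix.vec"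
    using that scalar_prod_self_eq_0[of x m] scalar_prod_self_nonneg[of x] by force
  have low: "- (L + 1) * (x \<bullet> x) \<le> x \<bullet> (A *\<^sub>v x)" if x: "x \<in> carrier_vec m" for x
  proof -
    have "0 \<le> (x + A *\<^sub>v x) \<bullet> (x + A *\<^sub>v x)" by (rule scalar_prod_self_nonneg)
    also have "\<dots> = x \<bullet> x + 2 * (x \<bullet> (A *\<^sub>v x)) + (A *\<^sub>v x) \<bullet> (A *\<^sub>v x)"
      using x A comm_scalar_prod[of x m "A *\<^sub>v x"]
      by (simp add: add_scalar_prod_distrib[of _ m] scalar_prod_add_distrib[of _ m] algebra_simps)
    also have "\<dots> \<le> (1 + L) * (x \<bullet> x) + 2 * (x \<bullet> (A *\<^sub>v x))"
      using L(2)[OF x] by (simp add: algebra_simps)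
    finally have "- ((L + 1) * (x \<bullet> x)) \<le> 2 * (x \<bullet> (A *\<^sub>v x))" by (simp add: algebra_simps)
    moreover have "0 \<le> (L + 1) * (x \<bullet> x)" using L scalar_prod_self_nonneg[of x] by simp
    ultimately show ?thesis unfolding minus_mult_left[symmetric] by linarith
  qed
  have bdd: "bdd_below R"
    unfolding R_def
  proof (rule bdd_belowI2[where m = "- (L + 1)"])
    fix x :: "real Matrix.vec" assume "x \<in> carrier_vec m - {0\<^sub>v m}"
    then show "- (L + 1) \<le> (x \<bullet> (A *\<^sub>v x)) / (x \<bullet> x)"
      using low[of x] pos[of x] by (auto simp: pos_le_divide_eq)
  qed
  have ne: "R \<noteq> {}"
  proof -
    have "unit_vec m 0 \<in> carrier_vec m - {0\<^sub>v m :: real Matrix.vec}"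
      using m by (auto simp: unit_vec_def zero_vec_def vec_eq_iff)
    then show ?thesis unfolding R_def by blast
  qed
  have lower: "\<mu> * (x \<bullet> x) \<le> x \<bullet> (A *\<^sub>v x)" if x: "x \<in> carrier_vec m" for x
  proof (cases "x = 0\<^sub>v m")
    case True
    then show ?thesis using A by simp
  next
    case False
    then have "\<mu> \<le> (x \<bullet> (A *\<^sub>v x)) / (x \<bullet> x)"
      unfolding \<mu>_def using x by (intro cInf_lower[OF _ bdd]) (auto simp: R_def)
    then show ?thesis using pos[OF x False] by (simp add: pos_le_divide_eq)
  qed
  have best: "\<nu> \<le> \<mu>" if "\<And>x. x \<in> carrier_vec m \<Longrightarrow> \<nu> * (x \<bullet> x) \<le> x \<bullet> (A *\<^sub>v x)" for \<nu>
    unfolding \<mu>_def using ne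
  proof (rule cInf_greatest)
    fix \<rho> assume "\<rho> \<in> R"
    then obtain x where x: "x \<in> carrier_vec m" "x \<noteq> 0\<^sub>v m" "\<rho> = (x \<bullet> (A *\<^sub>v x)) / (x \<bullet> x)"
      by (auto simp: R_def)
    show "\<nu> \<le> \<rho>"
      unfolding x(3) using that[OF x(1)] pos[OF x(1,2)] by (simp add: pos_le_divide_eq)
  qed
  have C: "char_matrix A \<mu> \<in> carrier_mat m m" using A by simp
  have C_form: "x \<bullet> (char_matrix A \<mu> *\<^sub>v x) = x \<bullet> (A *\<^sub>v x) - \<mu> * (x \<bullet> x)"
    if x: "x \<in> carrier_vec m" for x
    using A x unfolding char_matrix_def
    by (simp add: add_mult_distrib_mat_vec[of _ m m] scalar_prod_add_distrib[of _ m]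
         smult_mat_mult_vec[of _ m m])
  have "Determinant.det (char_matrix A \<mu>) = 0"
  proof (rule ccontr)
    assume det: "Determinant.det (char_matrix A \<mu>) \<noteq> 0"
    have "transpose_mat (char_matrix A \<mu>) = char_matrix A \<mu>"
      using A sym by (auto simp: char_matrix_def transpose_add[of _ m m] transpose_smult_mat)
    from psd_invertible_imp_coercive[OF C this _ det] lower C_form
    obtain \<kappa> where "\<kappa> > 0" "\<And>x. x \<in> carrier_vec m \<Longrightarrow> \<kappa> * (x \<bullet> x) \<le> x \<bullet> (char_matrix A \<mu> *\<^sub>v x)"
      by (metis diff_ge_0_iff_ge)
    then have "(\<mu> + \<kappa>) * (x \<bullet> x) \<le> x \<bullet> (A *\<^sub>v x)" if "x \<in> carrier_vec m" for x
      using C_form[OF that] that by (fastforce simp: distrib_right)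
    from best[OF this] \<open>\<kappa> > 0\<close> show False by simp
  qed
  then have "eigenvalue A \<mu>"
    using det_0_iff_vec_prod_zero_field[OF C] eigenvalue_char_matrix[OF A] by auto
  with lower show thesis using that by blast
qed

section \<open>Grouped linear fits and optimality of the penalised estimator\<close>

text \<open>The number of observations and the block sizes vary with \<open>n\<close>, so vectors are functions on \<open>nat\<close> read on an initial
segment.  This removes all dimension side conditions from the algebra below.\<close>

definition ip :: "nat \<Rightarrow> (nat \<Rightarrow> real) \<Rightarrow> (nat \<Rightarrow> real) \<Rightarrow> real" where
  "ip n u v = (\<Sum>i<n. u i * v i)"

text \<open>With \<open>x k j\<close> the \<open>j\<close>-th column of the block \<open>X_k\<close>, this is \<open>X_K b\<close> for the coefficients \<open>b\<close> restricted to the groups in \<open>K\<close>.\<close>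

definition fit ::
  "nat set \<Rightarrow> (nat \<Rightarrow> nat) \<Rightarrow> (nat \<Rightarrow> nat \<Rightarrow> nat \<Rightarrow> real) \<Rightarrow> (nat \<Rightarrow> nat \<Rightarrow> real) \<Rightarrow> nat \<Rightarrow> real" where
  "fit K d x b i = (\<Sum>k\<in>K. \<Sum>j<d k. b k j * x k j i)"

abbreviation gnorm :: "(nat \<Rightarrow> nat) \<Rightarrow> (nat \<Rightarrow> nat \<Rightarrow> real) \<Rightarrow> nat \<Rightarrow> real" where
  "gnorm d b k \<equiv> L2_set (b k) {..<d k}"

lemma ip_add_left: "ip n (\<lambda>i. u i + v i) w = ip n u w + ip n v w"
  by (simp add: ip_def algebra_simps sum.distrib)

lemma ip_diff_left: "ip n (\<lambda>i. u i - v i) w = ip n u w - ip n v w"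
  by (simp add: ip_def algebra_simps sum_subtractf)

lemma ip_minus_right: "ip n u (\<lambda>i. - v i) = - ip n u v"
  by (simp add: ip_def sum_negf)

lemma ip_commute: "ip n u v = ip n v u"
  by (simp add: ip_def mult.commute)

lemma ip_self: "ip n v v = (L2_set v {..<n})\<^sup>2"
  by (simp add: ip_def L2_set_def sum_nonneg power2_eq_square)

lemma ip_cong: "(\<And>i. i < n \<Longrightarrow> u i = u' i) \<Longrightarrow> (\<And>i. i < n \<Longrightarrow> v i = v' i) \<Longrightarrow> ip n u v = ip n u' v'"
  by (simp add: ip_def)

lemma ip_sum_right: "ip n u (\<lambda>i. \<Sum>k\<in>K. \<Sum>j<d k. b k j * x k j i) = (\<Sum>k\<in>K. \<Sum>j<d k. b k j * ip n u (x k j))"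
  unfolding ip_def sum_distrib_left
  by (subst sum.swap, rule sum.cong[OF refl], subst sum.swap) (simp add: mult_ac)

lemma ip_fit_right: "ip n u (fit K d x b) = (\<Sum>k\<in>K. \<Sum>j<d k. b k j * ip n u (x k j))"
  unfolding fit_def ip_sum_right ..

lemma ip_le_L2: "\<bar>\<Sum>j\<in>J. u j * v j\<bar> \<le> L2_set u J * L2_set v J"
proof -
  have "\<bar>\<Sum>j\<in>J. u j * v j\<bar> \<le> (\<Sum>j\<in>J. \<bar>u j\<bar> * \<bar>v j\<bar>)"
    by (rule order_trans[OF sum_abs]) (simp add: abs_mult)
  with L2_set_mult_ineq show ?thesis by (rule order_trans[rotated])
qed

lemma L2_set_scale: "L2_set (\<lambda>j. c * f j) J = \<bar>c\<bar> * L2_set f J"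
  by (simp add: L2_set_def power_mult_distrib sum_distrib_left[symmetric] real_sqrt_mult)

lemma L2_set_sum_le: "finite I \<Longrightarrow> L2_set (\<lambda>j. \<Sum>i\<in>I. f i j) J \<le> (\<Sum>i\<in>I. L2_set (f i) J)"
proof (induction I rule: finite_induct)
  case empty
  show ?case by (simp add: L2_set_def)
next
  case (insert i I)
  then show ?case
    using L2_set_triangle_ineq[of "f i" "\<lambda>j. \<Sum>i\<in>I. f i j" J] by simp
qed

lemma fit_add: "fit K d x (\<lambda>k j. b k j + c k j) i = fit K d x b i + fit K d x c i"
  by (simp add: fit_def algebra_simps sum.distrib)

lemma fit_diff: "fit K d x (\<lambda>k j. b k j - c k j) i = fit K d x b i - fit K d x c i"
  by (simp add: fit_def algebra_simps sum_subtractf)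

lemma fit_scale: "fit K d x (\<lambda>k j. t * b k j) i = t * fit K d x b i"
  by (simp add: fit_def algebra_simps sum_distrib_left)

lemma fit_cong: "(\<And>k j. k \<in> K \<Longrightarrow> j < d k \<Longrightarrow> b k j = c k j) \<Longrightarrow> fit K d x b i = fit K d x c i"
  by (simp add: fit_def)

lemma fit_union:
  "finite S \<Longrightarrow> finite A \<Longrightarrow> S \<inter> A = {} \<Longrightarrow> fit (S \<union> A) d x b i = fit S d x b i + fit A d x b i"
  by (simp add: fit_def sum.union_disjoint)

lemma fit_0: "(\<And>k j. k \<in> K \<Longrightarrow> j < d k \<Longrightarrow> b k j = 0) \<Longrightarrow> fit K d x b i = 0"
  by (simp add: fit_def)

text \<open>The first-order condition for a quadratic loss with a convex penalty.  \<open>F\<close> is the set of groups of finite weight, on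
which alone the minimisation takes place.  Along the segment from \<open>h\<close> to \<open>h + \<gamma>\<close> the penalty is below its chord, and the
quadratic term of the loss is of second order in the step length \<open>t\<close>.\<close>

lemma variational_inequality:
  fixes x :: "nat \<Rightarrow> nat \<Rightarrow> nat \<Rightarrow> real"
  assumes \<mu>: "\<And>k. k \<in> F \<Longrightarrow> 0 \<le> \<mu> k"
    and h0: "\<And>k j. k \<in> P - F \<Longrightarrow> j < d k \<Longrightarrow> h k j = 0"
    and min: "\<And>b. (\<And>k j. k \<in> P - F \<Longrightarrow> j < d k \<Longrightarrow> b k j = 0) \<Longrightarrow>
        1/2 * ip n (\<lambda>i. y i - fit P d x h i) (\<lambda>i. y i - fit P d x h i) + (\<Sum>k\<in>F. \<mu> k * gnorm d h k)
        \<le> 1/2 * ip n (\<lambda>i. y i - fit P d x b i) (\<lambda>i. y i - fit P d x b i) + (\<Sum>k\<in>F. \<mu> k * gnorm d b k)"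
    and \<gamma>0: "\<And>k j. k \<in> P - F \<Longrightarrow> j < d k \<Longrightarrow> \<gamma> k j = 0"
  shows "ip n (\<lambda>i. y i - fit P d x h i) (fit P d x \<gamma>)
      \<le> (\<Sum>k\<in>F. \<mu> k * (L2_set (\<lambda>j. h k j + \<gamma> k j) {..<d k} - gnorm d h k))"
    (is "?l \<le> ?D")
proof (rule ccontr)
  assume gap: "\<not> ?l \<le> ?D"
  define R where "R = (\<lambda>i. y i - fit P d x h i)"
  define v where "v = fit P d x \<gamma>"
  have step: "?l \<le> t / 2 * ip n v v + ?D" if t: "0 < t" "t \<le> 1" for t
  proof -
    let ?b = "\<lambda>k j. h k j + t * \<gamma> k j"
    have fit_b: "fit P d x ?b i = fit P d x h i + t * v i" for i
      by (simp add: fit_add fit_scale v_def)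
    have pen: "(\<Sum>k\<in>F. \<mu> k * gnorm d ?b k) \<le> (\<Sum>k\<in>F. \<mu> k * gnorm d h k) + t * ?D"
    proof -
      have "gnorm d ?b k \<le> gnorm d h k + t * (L2_set (\<lambda>j. h k j + \<gamma> k j) {..<d k} - gnorm d h k)" for k
      proof -
        have "gnorm d ?b k = L2_set (\<lambda>j. (1 - t) * h k j + t * (h k j + \<gamma> k j)) {..<d k}"
          by (simp add: algebra_simps)
        also have "\<dots> \<le> L2_set (\<lambda>j. (1 - t) * h k j) {..<d k} + L2_set (\<lambda>j. t * (h k j + \<gamma> k j)) {..<d k}"
          by (rule L2_set_triangle_ineq)
        also have "\<dots> = (1 - t) * gnorm d h k + t * L2_set (\<lambda>j. h k j + \<gamma> k j) {..<d k}"
          unfolding L2_set_scale using t by simp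
        finally show ?thesis by (simp only: left_diff_distrib right_diff_distrib)
      qed
      then have "(\<Sum>k\<in>F. \<mu> k * gnorm d ?b k) \<le>
          (\<Sum>k\<in>F. \<mu> k * (gnorm d h k + t * (L2_set (\<lambda>j. h k j + \<gamma> k j) {..<d k} - gnorm d h k)))"
        using \<mu> by (intro sum_mono mult_left_mono) auto
      also have "\<dots> = (\<Sum>k\<in>F. \<mu> k * gnorm d h k) + t * ?D"
        by (simp add: algebra_simps sum.distrib sum_distrib_left sum_subtractf)
      finally show ?thesis .
    qed
    have sq: "ip n (\<lambda>i. y i - fit P d x ?b i) (\<lambda>i. y i - fit P d x ?b i)
        = ip n R R - 2 * t * ip n R v + t * t * ip n v v"
      unfolding ip_def fit_b R_def
      by (simp add: algebra_simps sum.distrib sum_subtractf sum_distrib_left)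
    have "1/2 * ip n R R + (\<Sum>k\<in>F. \<mu> k * gnorm d h k)
        \<le> 1/2 * (ip n R R - 2 * t * ip n R v + t * t * ip n v v) + (\<Sum>k\<in>F. \<mu> k * gnorm d ?b k)"
      using min[of ?b] h0 \<gamma>0 unfolding sq by (simp add: R_def)
    with pen have "t * ip n R v \<le> t * (t / 2 * ip n v v + ?D)" by (simp add: algebra_simps)
    with t(1) have "ip n R v \<le> t / 2 * ip n v v + ?D" by (simp only: mult_le_cancel_left_pos)
    then show ?thesis by (simp add: R_def v_def)
  qed
  have vv: "0 \<le> ip n v v" by (simp add: ip_self)
  \<comment> \<open>A step so short that the second-order term uses up at most half of the gap.\<close>
  define t where "t = min 1 ((?l - ?D) / (ip n v v + 1))"
  have t: "0 < t" "t \<le> 1" "t \<le> (?l - ?D) / (ip n v v + 1)" using gap vv by (auto simp: t_def)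
  have "t * ip n v v \<le> t * (ip n v v + 1)" using t by simp
  also have "\<dots> \<le> ?l - ?D"
    using t(3) vv by (subst (asm) pos_le_divide_eq) auto
  finally have "t / 2 * ip n v v \<le> (?l - ?D) / 2" by simp
  then show False using step[OF t(1,2)] gap by argo
qed

text \<open>The coefficients \<open>g k j\<close> are those of the regression of the null column \<open>x k j\<close> on the signal columns.  The perturbation \<open>\<gamma>\<close>
deletes the null groups of \<open>h\<close> and adds \<open>g\<close>-combinations on \<open>S\<close> so that the fit moves by \<open>- \<rho>\<close>, a combination of
regression residuals.  Because \<open>\<rho>\<close> is orthogonal to the signal columns, neither \<open>\<beta>\<close> nor the error of \<open>h\<close> on \<open>S\<close> appears in
the resulting inequality; what remains is linear in the norms of the deleted groups, with strictly positive
coefficients by the hypothesis \<open>strict\<close>.\<close>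

lemma null_groups_vanish:
  fixes x :: "nat \<Rightarrow> nat \<Rightarrow> nat \<Rightarrow> real" and g :: "nat \<Rightarrow> nat \<Rightarrow> nat \<Rightarrow> nat \<Rightarrow> real"
  assumes fin: "finite S" "finite A" and disj: "S \<inter> A = {}" and SF: "S \<subseteq> F" and FP: "F \<subseteq> S \<union> A"
    and y: "\<And>i. i < n \<Longrightarrow> y i = fit S d x \<beta> i + \<epsilon> i"
    and h0: "\<And>k j. k \<in> A - F \<Longrightarrow> j < d k \<Longrightarrow> h k j = 0"
    and vi: "\<And>\<gamma>. (\<And>k j. k \<in> A - F \<Longrightarrow> j < d k \<Longrightarrow> \<gamma> k j = 0) \<Longrightarrow>
        ip n (\<lambda>i. y i - fit (S \<union> A) d x h i) (fit (S \<union> A) d x \<gamma>)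
        \<le> (\<Sum>k\<in>F. \<mu> k * (L2_set (\<lambda>j. h k j + \<gamma> k j) {..<d k} - gnorm d h k))"
    and \<mu>: "\<And>k. k \<in> S \<Longrightarrow> 0 \<le> \<mu> k \<and> \<mu> k \<le> m"
    and m: "0 \<le> m"
    and orth: "\<And>k j b. k \<in> A \<Longrightarrow> j < d k \<Longrightarrow> ip n (\<lambda>i. x k j i - fit S d x (g k j) i) (fit S d x b) = 0"
    and G: "\<And>k j. k \<in> A \<Longrightarrow> j < d k \<Longrightarrow> (\<Sum>l\<in>S. gnorm d (g k j) l) \<le> G"
    and strict: "\<And>k. k \<in> A \<inter> F \<Longrightarrow>
        L2_set (\<lambda>j. ip n \<epsilon> (\<lambda>i. x k j i - fit S d x (g k j) i)) {..<d k} + m * G * sqrt (d k) < \<mu> k"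
    and k: "k \<in> A"
  shows "gnorm d h k = 0"
proof -
  define \<gamma> where "\<gamma> = (\<lambda>k j. if k \<in> S then \<Sum>a\<in>A. \<Sum>l<d a. h a l * g a l k j else - h k j)"
  define r where "r = (\<lambda>k j i. x k j i - fit S d x (g k j) i)"
  define \<rho> where "\<rho> = (\<lambda>i. \<Sum>a\<in>A. \<Sum>l<d a. h a l * r a l i)"
  define N where "N = (\<lambda>k. L2_set (\<lambda>j. ip n \<epsilon> (r k j)) {..<d k})"
  have S_A: "k \<notin> S" if "k \<in> A" for k using disj that by auto
  have fit_S: "fit S d x \<gamma> i = (\<Sum>a\<in>A. \<Sum>l<d a. h a l * fit S d x (g a l) i)" for i
  proof -
    have "fit S d x \<gamma> i = (\<Sum>k\<in>S. \<Sum>j<d k. \<Sum>a\<in>A. \<Sum>l<d a. h a l * (g a l k j * x k j i))"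
      by (simp add: fit_def \<gamma>_def sum_distrib_right mult.assoc)
    also have "\<dots> = (\<Sum>k\<in>S. \<Sum>a\<in>A. \<Sum>j<d k. \<Sum>l<d a. h a l * (g a l k j * x k j i))"
      by (intro sum.cong refl sum.swap)
    also have "\<dots> = (\<Sum>a\<in>A. \<Sum>k\<in>S. \<Sum>j<d k. \<Sum>l<d a. h a l * (g a l k j * x k j i))"
      by (rule sum.swap)
    also have "\<dots> = (\<Sum>a\<in>A. \<Sum>k\<in>S. \<Sum>l<d a. \<Sum>j<d k. h a l * (g a l k j * x k j i))"
      by (intro sum.cong refl sum.swap)
    also have "\<dots> = (\<Sum>a\<in>A. \<Sum>l<d a. \<Sum>k\<in>S. \<Sum>j<d k. h a l * (g a l k j * x k j i))"
      by (intro sum.cong refl sum.swap)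
    finally show ?thesis by (simp add: fit_def sum_distrib_left)
  qed
  have fit_A: "fit A d x h i = \<rho> i + fit S d x \<gamma> i" for i
    unfolding fit_S by (simp add: \<rho>_def r_def fit_def[of A] algebra_simps sum_subtractf)
  have fit_A': "fit A d x \<gamma> i = - fit A d x h i" for i
    using S_A by (simp add: \<gamma>_def fit_def sum_negf)
  have fit_all: "fit (S \<union> A) d x \<gamma> i = - \<rho> i" for i
    using fit_union[OF fin disj] fit_A[of i] fit_A'[of i] by simp
  have \<rho>_orth: "ip n (fit S d x b) \<rho> = 0" for b
    unfolding \<rho>_def ip_sum_right using orth
    by (intro sum.neutral ballI) (simp add: r_def ip_commute[of n "fit S d x b"])
  have "ip n (\<lambda>i. y i - fit (S \<union> A) d x h i) \<rho>
      = ip n (\<lambda>i. (\<epsilon> i + fit S d x (\<lambda>k j. \<beta> k j - h k j - \<gamma> k j) i) - \<rho> i) \<rho>"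
    by (rule ip_cong) (use y fit_A in \<open>auto simp: fit_union[OF fin disj] fit_diff\<close>)
  also have "\<dots> = ip n \<epsilon> \<rho> - ip n \<rho> \<rho>"
    by (simp add: ip_diff_left ip_add_left \<rho>_orth)
  finally have 1: "ip n (\<lambda>i. y i - fit (S \<union> A) d x h i) (fit (S \<union> A) d x \<gamma>) = ip n \<rho> \<rho> - ip n \<epsilon> \<rho>"
    by (simp add: fit_all[abs_def] ip_minus_right)
  \<comment> \<open>On \<open>A\<close> the perturbation removes the whole penalty; on \<open>S\<close> it adds at most the penalty of \<open>\<gamma>\<close>.\<close>
  have F: "F = S \<union> (A \<inter> F)" "S \<inter> (A \<inter> F) = {}" using SF FP disj by auto
  have finF: "finite (A \<inter> F)" using fin by simp
  have "ip n \<rho> \<rho> - ip n \<epsilon> \<rho> \<le> (\<Sum>k\<in>F. \<mu> k * (L2_set (\<lambda>j. h k j + \<gamma> k j) {..<d k} - gnorm d h k))"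
    unfolding 1[symmetric] by (rule vi) (use h0 S_A in \<open>auto simp: \<gamma>_def\<close>)
  also have "\<dots> = (\<Sum>k\<in>S. \<mu> k * (L2_set (\<lambda>j. h k j + \<gamma> k j) {..<d k} - gnorm d h k))
      + (\<Sum>k\<in>A \<inter> F. \<mu> k * (L2_set (\<lambda>j. h k j + \<gamma> k j) {..<d k} - gnorm d h k))"
    by (subst F(1), rule sum.union_disjoint[OF fin(1) finF F(2)])
  also have "(\<Sum>k\<in>A \<inter> F. \<mu> k * (L2_set (\<lambda>j. h k j + \<gamma> k j) {..<d k} - gnorm d h k))
      = - (\<Sum>k\<in>A \<inter> F. \<mu> k * gnorm d h k)"
    using S_A by (simp add: \<gamma>_def L2_set_def sum_negf)
  also have "(\<Sum>k\<in>S. \<mu> k * (L2_set (\<lambda>j. h k j + \<gamma> k j) {..<d k} - gnorm d h k))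
      \<le> (\<Sum>k\<in>S. m * gnorm d \<gamma> k)"
  proof (rule sum_mono)
    fix k assume k: "k \<in> S"
    have "\<mu> k * (L2_set (\<lambda>j. h k j + \<gamma> k j) {..<d k} - gnorm d h k) \<le> \<mu> k * gnorm d \<gamma> k"
      using \<mu>[OF k] L2_set_triangle_ineq[of "h k" "\<gamma> k" "{..<d k}"] by (intro mult_left_mono) auto
    also have "\<dots> \<le> m * gnorm d \<gamma> k"
      using \<mu>[OF k] by (intro mult_right_mono) (auto simp: L2_set_nonneg)
    finally show "\<mu> k * (L2_set (\<lambda>j. h k j + \<gamma> k j) {..<d k} - gnorm d h k) \<le> m * gnorm d \<gamma> k" .
  qed
  also have "(\<Sum>k\<in>S. m * gnorm d \<gamma> k) \<le> (\<Sum>a\<in>A. m * G * sqrt (d a) * gnorm d h a)"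
  proof -
    have "gnorm d \<gamma> k \<le> (\<Sum>a\<in>A. \<Sum>l<d a. \<bar>h a l\<bar> * gnorm d (g a l) k)" if "k \<in> S" for k
    proof -
      have "gnorm d \<gamma> k = L2_set (\<lambda>j. \<Sum>a\<in>A. \<Sum>l<d a. h a l * g a l k j) {..<d k}"
        using that by (simp add: \<gamma>_def)
      also have "\<dots> \<le> (\<Sum>a\<in>A. L2_set (\<lambda>j. \<Sum>l<d a. h a l * g a l k j) {..<d k})"
        by (rule L2_set_sum_le[OF fin(2)])
      also have "\<dots> \<le> (\<Sum>a\<in>A. \<Sum>l<d a. L2_set (\<lambda>j. h a l * g a l k j) {..<d k})"
        by (intro sum_mono L2_set_sum_le) simp
      finally show ?thesis by (simp add: L2_set_scale)
    qed
    then have "(\<Sum>k\<in>S. gnorm d \<gamma> k) \<le> (\<Sum>k\<in>S. \<Sum>a\<in>A. \<Sum>l<d a. \<bar>h a l\<bar> * gnorm d (g a l) k)"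
      by (rule sum_mono)
    also have "\<dots> = (\<Sum>a\<in>A. \<Sum>l<d a. \<bar>h a l\<bar> * (\<Sum>k\<in>S. gnorm d (g a l) k))"
      unfolding sum_distrib_left by (subst sum.swap, rule sum.cong[OF refl], rule sum.swap)
    also have "\<dots> \<le> (\<Sum>a\<in>A. \<Sum>l<d a. \<bar>h a l\<bar> * G)"
      using G by (intro sum_mono mult_left_mono) auto
    also have "\<dots> \<le> (\<Sum>a\<in>A. G * sqrt (d a) * gnorm d h a)"
    proof (rule sum_mono)
      fix a assume a: "a \<in> A"
      show "(\<Sum>l<d a. \<bar>h a l\<bar> * G) \<le> G * sqrt (d a) * gnorm d h a"
      proof (cases "d a = 0")
        case False
        have "0 \<le> (\<Sum>l\<in>S. gnorm d (g a 0) l)" by (intro sum_nonneg L2_set_nonneg)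
        then have G0: "0 \<le> G" using G[OF a, of 0] False by linarith
        have "(\<Sum>l<d a. \<bar>h a l\<bar>) \<le> gnorm d h a * sqrt (d a)"
          using L2_set_mult_ineq[of "h a" "\<lambda>_. 1" "{..<d a}"] by (simp add: L2_set_constant)
        then have "(\<Sum>l<d a. \<bar>h a l\<bar>) * G \<le> (gnorm d h a * sqrt (d a)) * G"
          using G0 by (rule mult_right_mono)
        then show ?thesis unfolding sum_distrib_right[symmetric] by (simp only: mult_ac)
      qed simp
    qed
    finally have "m * (\<Sum>k\<in>S. gnorm d \<gamma> k) \<le> m * (\<Sum>a\<in>A. G * sqrt (d a) * gnorm d h a)"
      using m by (rule mult_left_mono)
    then show ?thesis by (simp add: sum_distrib_left mult_ac)
  qed
  finally have 2: "ip n \<rho> \<rho> + (\<Sum>k\<in>A \<inter> F. \<mu> k * gnorm d h k)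
      \<le> ip n \<epsilon> \<rho> + (\<Sum>a\<in>A. m * G * sqrt (d a) * gnorm d h a)"
    by simp
  have \<rho>_sq: "0 \<le> ip n \<rho> \<rho>" by (simp add: ip_self)
  have "ip n \<epsilon> \<rho> = (\<Sum>a\<in>A. \<Sum>l<d a. h a l * ip n \<epsilon> (r a l))"
    unfolding \<rho>_def ip_sum_right ..
  also have "\<dots> \<le> (\<Sum>a\<in>A. gnorm d h a * N a)"
    unfolding N_def by (intro sum_mono order_trans[OF abs_ge_self ip_le_L2])
  finally have "(\<Sum>k\<in>A \<inter> F. \<mu> k * gnorm d h k) \<le> (\<Sum>a\<in>A. (N a + m * G * sqrt (d a)) * gnorm d h a)"
    using 2 \<rho>_sq by (simp add: sum.distrib distrib_right mult.commute[of "gnorm d h _"])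
  also have "\<dots> = (\<Sum>a\<in>A \<inter> F. (N a + m * G * sqrt (d a)) * gnorm d h a)"
    using fin h0 by (intro sum.mono_neutral_right) (auto simp: L2_set_def)
  finally have "(\<Sum>a\<in>A \<inter> F. (\<mu> a - (N a + m * G * sqrt (d a))) * gnorm d h a) \<le> 0"
    by (simp add: sum_subtractf left_diff_distrib)
  moreover have nn: "0 \<le> (\<mu> a - (N a + m * G * sqrt (d a))) * gnorm d h a" if "a \<in> A \<inter> F" for a
    using strict[OF that] by (intro mult_nonneg_nonneg) (auto simp: N_def r_def L2_set_nonneg)
  ultimately have "(\<Sum>a\<in>A \<inter> F. (\<mu> a - (N a + m * G * sqrt (d a))) * gnorm d h a) = 0"
    by (intro order_antisym sum_nonneg)
  then have "\<forall>a\<in>A \<inter> F. (\<mu> a - (N a + m * G * sqrt (d a))) * gnorm d h a = 0"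
    by (subst (asm) sum_nonneg_eq_0_iff[OF finF nn]) auto
  then have "gnorm d h a = 0" if "a \<in> A \<inter> F" for a
    using strict[OF that] that by (force simp: N_def r_def)
  with k h0 show ?thesis by (cases "k \<in> F") (auto simp: L2_set_def)
qed

text \<open>The hypothesis on \<open>g\<close> says that it solves the normal equations with right-hand side \<open>u\<close> placed in block \<open>k0\<close>.  Testing with it
isolates the estimation error in that single block along \<open>u\<close>, which is \<open>|\<beta>_k0|\<close> if the block is estimated by zero.
Testing with both signs turns the variational inequality into a bound on an absolute value.\<close>

lemma vanishing_group_noise:
  fixes x :: "nat \<Rightarrow> nat \<Rightarrow> nat \<Rightarrow> real"
  assumes fin: "finite S" "finite A" and disj: "S \<inter> A = {}" and SF: "S \<subseteq> F" and FP: "F \<subseteq> S \<union> A"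
    and y: "\<And>i. i < n \<Longrightarrow> y i = fit S d x \<beta> i + \<epsilon> i"
    and vi: "\<And>\<gamma>. (\<And>k j. k \<in> A - F \<Longrightarrow> j < d k \<Longrightarrow> \<gamma> k j = 0) \<Longrightarrow>
        ip n (\<lambda>i. y i - fit (S \<union> A) d x h i) (fit (S \<union> A) d x \<gamma>)
        \<le> (\<Sum>k\<in>F. \<mu> k * (L2_set (\<lambda>j. h k j + \<gamma> k j) {..<d k} - gnorm d h k))"
    and \<mu>: "\<And>k. k \<in> S \<Longrightarrow> 0 \<le> \<mu> k \<and> \<mu> k \<le> m"
    and hA: "\<And>k. k \<in> A \<Longrightarrow> gnorm d h k = 0"
    and k0: "k0 \<in> S" "gnorm d h k0 = 0"
    and g: "\<And>b. ip n (fit S d x g) (fit S d x b) = (\<Sum>j<d k0. u j * b k0 j)"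
    and u: "(\<Sum>j<d k0. u j * \<beta> k0 j) = gnorm d \<beta> k0"
    and G: "(\<Sum>l\<in>S. gnorm d g l) \<le> G"
  shows "\<bar>ip n \<epsilon> (fit S d x g) + gnorm d \<beta> k0\<bar> \<le> m * G"
proof -
  have S_A: "k \<notin> S" if "k \<in> A" for k using disj that by auto
  have m: "0 \<le> m" using \<mu>[OF k0(1)] by simp
  have hA0: "h k j = 0" if "k \<in> A" "j < d k" for k j
    using hA[OF that(1)] that by (simp add: L2_set_eq_0_iff)
  have hk0: "h k0 j = 0" if "j < d k0" for j using k0 that by (simp add: L2_set_eq_0_iff)
  have R: "ip n (\<lambda>i. y i - fit (S \<union> A) d x h i) (fit S d x g) = ip n \<epsilon> (fit S d x g) + gnorm d \<beta> k0"
  proof -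
    have "ip n (\<lambda>i. y i - fit (S \<union> A) d x h i) (fit S d x g)
        = ip n (\<lambda>i. \<epsilon> i + fit S d x (\<lambda>k j. \<beta> k j - h k j) i) (fit S d x g)"
      by (rule ip_cong) (use y hA0 in \<open>auto simp: fit_union[OF fin disj] fit_diff fit_0[of A]\<close>)
    also have "\<dots> = ip n \<epsilon> (fit S d x g) + ip n (fit S d x g) (fit S d x (\<lambda>k j. \<beta> k j - h k j))"
      by (simp add: ip_add_left ip_commute[of n "fit S d x g"])
    also have "ip n (fit S d x g) (fit S d x (\<lambda>k j. \<beta> k j - h k j)) = gnorm d \<beta> k0"
      unfolding g u[symmetric] by (simp add: hk0)
    finally show ?thesis .
  qed
  have bound: "s * (ip n \<epsilon> (fit S d x g) + gnorm d \<beta> k0) \<le> m * G" if s: "\<bar>s\<bar> = 1" for s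
  proof -
    define \<gamma> where "\<gamma> = (\<lambda>k j. if k \<in> S then s * g k j else 0)"
    have "fit (S \<union> A) d x \<gamma> i = s * fit S d x g i" for i
      using S_A unfolding fit_scale[symmetric]
      by (auto simp: fit_union[OF fin disj] fit_0[of A] \<gamma>_def intro: fit_cong)
    then have "ip n (\<lambda>i. y i - fit (S \<union> A) d x h i) (fit (S \<union> A) d x \<gamma>)
        = s * (ip n \<epsilon> (fit S d x g) + gnorm d \<beta> k0)"
      unfolding R[symmetric] by (simp add: ip_def sum_distrib_left mult_ac)
    then have "s * (ip n \<epsilon> (fit S d x g) + gnorm d \<beta> k0)
        \<le> (\<Sum>k\<in>F. \<mu> k * (L2_set (\<lambda>j. h k j + \<gamma> k j) {..<d k} - gnorm d h k))"
      using vi[of \<gamma>] S_A by (auto simp: \<gamma>_def)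
    also have "\<dots> = (\<Sum>k\<in>S. \<mu> k * (L2_set (\<lambda>j. h k j + \<gamma> k j) {..<d k} - gnorm d h k))"
      using SF FP fin finite_subset[OF FP] by (intro sum.mono_neutral_right) (auto simp: \<gamma>_def)
    also have "\<dots> \<le> (\<Sum>k\<in>S. m * gnorm d g k)"
    proof (rule sum_mono)
      fix k assume k: "k \<in> S"
      have \<gamma>k: "gnorm d \<gamma> k = gnorm d g k" using k s by (simp add: \<gamma>_def L2_set_scale)
      have "\<mu> k * (L2_set (\<lambda>j. h k j + \<gamma> k j) {..<d k} - gnorm d h k) \<le> \<mu> k * gnorm d \<gamma> k"
        using \<mu>[OF k] L2_set_triangle_ineq[of "h k" "\<gamma> k" "{..<d k}"] by (intro mult_left_mono) auto
      also have "\<dots> \<le> m * gnorm d g k"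
        unfolding \<gamma>k using \<mu>[OF k] by (intro mult_right_mono) (auto simp: L2_set_nonneg)
      finally show "\<mu> k * (L2_set (\<lambda>j. h k j + \<gamma> k j) {..<d k} - gnorm d h k) \<le> m * gnorm d g k" .
    qed
    also have "\<dots> \<le> m * G" unfolding sum_distrib_left[symmetric] using G m by (rule mult_left_mono)
    finally show ?thesis .
  qed
  show ?thesis using bound[of 1] bound[of "-1"] by (simp add: abs_le_iff)
qed

section \<open>Block matrices as grouped fits\<close>

lemma sum_lessThan_add:
  fixes f :: "nat \<Rightarrow> 'b :: comm_monoid_add"
  shows "(\<Sum>l<a + b. f l) = (\<Sum>l<a. f l) + (\<Sum>l<b. f (a + l))"
  by (induction b) (simp_all add: add.assoc)

lemma length_concat_blocks:
  assumes "\<And>k. k \<in> {1..q} \<Longrightarrow> length (us k) = d k"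
  shows "length (concat (map us [1..<Suc q])) = sum d {1..q}"
  using assms by (induction q) auto

text \<open>Matrix-vector products and scalar products of stacked blocks are sums along two concatenated lists that are cut into blocks
of matching lengths; this turns both into double sums over groups.\<close>

lemma sum_concat_blocks:
  fixes f :: "'u \<Rightarrow> 'v \<Rightarrow> real"
  assumes "\<And>k. k \<in> {1..q} \<Longrightarrow> length (us k) = d k" "\<And>k. k \<in> {1..q} \<Longrightarrow> length (vs k) = d k"
  shows "(\<Sum>l<sum d {1..q}. f (concat (map us [1..<Suc q]) ! l) (concat (map vs [1..<Suc q]) ! l))
      = (\<Sum>k\<in>{1..q}. \<Sum>j<d k. f (us k ! j) (vs k ! j))"
  using assms
proof (induction q)
  case 0
  show ?case by simp
next
  case (Suc q)
  have l: "length (concat (map us [1..<Suc q])) = sum d {1..q}" "length (concat (map vs [1..<Suc q])) = sum d {1..q}"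
    using Suc.prems by (intro length_concat_blocks; simp)+
  have IH: "(\<Sum>l<sum d {1..q}. f (concat (map us [1..<Suc q]) ! l) (concat (map vs [1..<Suc q]) ! l))
      = (\<Sum>k\<in>{1..q}. \<Sum>j<d k. f (us k ! j) (vs k ! j))"
    using Suc by simp
  have app: "concat (map us [1..<Suc (Suc q)]) = concat (map us [1..<Suc q]) @ us (Suc q)"
    "concat (map vs [1..<Suc (Suc q)]) = concat (map vs [1..<Suc q]) @ vs (Suc q)" by simp_all
  have "sum d {1..Suc q} = sum d {1..q} + d (Suc q)" by simp
  then show ?case
    unfolding app using IH l by (simp add: sum_lessThan_add nth_append del: upt_Suc)
qed

lemma block_cols_upto:
  "block_cols n X {1..q} = mat_of_cols n (concat (map (\<lambda>k. cols (X k)) [1..<Suc q]))"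
  unfolding block_cols_def
  by (simp add: atLeastLessThanSuc_atLeastAtMost[symmetric] del: upt_Suc)

lemma stack_upto: "stack q b = vec_of_list (concat (map (\<lambda>k. list_of_vec (b k)) [1..<Suc q]))"
  unfolding stack_def
  by (simp add: atLeastLessThanSuc_atLeastAtMost[symmetric] del: upt_Suc)

lemma stack_carrier:
  assumes "\<And>k. k \<in> {1..q} \<Longrightarrow> b k \<in> carrier_vec (d k)"
  shows "stack q b \<in> carrier_vec (sum d {1..q})"
proof -
  have "length (concat (map (\<lambda>k. list_of_vec (b k)) [1..<Suc q])) = sum d {1..q}"
    by (rule length_concat_blocks) (use assms in auto)
  then show ?thesis unfolding stack_upto by (intro carrier_vecI) (simp only: dim_vec_of_list)
qed

lemma block_cols_carrier:
  assumes "\<And>k. k \<in> {1..q} \<Longrightarrow> X k \<in> carrier_mat n (d k)"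
  shows "block_cols n X {1..q} \<in> carrier_mat n (sum d {1..q})"
proof -
  have "length (concat (map (\<lambda>k. cols (X k)) [1..<Suc q])) = sum d {1..q}"
    by (rule length_concat_blocks) (use assms in auto)
  then show ?thesis
    unfolding block_cols_upto
    using mat_of_cols_carrier(1)[of n "concat (map (\<lambda>k. cols (X k)) [1..<Suc q])"] by (simp only:)
qed

lemma scalar_prod_stack:
  assumes "\<And>k. k \<in> {1..q} \<Longrightarrow> b k \<in> carrier_vec (d k)" "\<And>k. k \<in> {1..q} \<Longrightarrow> c k \<in> carrier_vec (d k)"
  shows "stack q b \<bullet> stack q c = (\<Sum>k\<in>{1..q}. \<Sum>j<d k. b k $ j * c k $ j)"
proof -
  have "stack q b \<bullet> stack q c = (\<Sum>l<sum d {1..q}. stack q b $ l * stack q c $ l)"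
    using stack_carrier[of q c d] assms by (simp add: scalar_prod_def lessThan_atLeast0)
  also have "\<dots> = (\<Sum>k\<in>{1..q}. \<Sum>j<d k. list_of_vec (b k) ! j * list_of_vec (c k) ! j)"
    unfolding stack_upto vec_of_list_index
    by (rule sum_concat_blocks) (use assms in auto)
  finally show ?thesis by (simp add: list_of_vec_index)
qed

lemma lin_pred_index:
  assumes "\<And>k. k \<in> {1..q} \<Longrightarrow> X k \<in> carrier_mat n (d k)" "\<And>k. k \<in> {1..q} \<Longrightarrow> b k \<in> carrier_vec (d k)"
    and i: "i < n"
  shows "lin_pred n q X b $ i = fit {1..q} d (\<lambda>k j i. X k $$ (i, j)) (\<lambda>k j. b k $ j) i"
proof -
  let ?B = "block_cols n X {1..q}"
  let ?cs = "concat (map (\<lambda>k. cols (X k)) [1..<Suc q])"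
  have len: "length ?cs = sum d {1..q}"
    by (rule length_concat_blocks) (use assms(1) in auto)
  have B: "?B \<in> carrier_mat n (sum d {1..q})" by (rule block_cols_carrier) (use assms(1) in auto)
  have s: "stack q b \<in> carrier_vec (sum d {1..q})" by (rule stack_carrier) (use assms(2) in auto)
  have "lin_pred n q X b $ i = (\<Sum>l<sum d {1..q}. ?B $$ (i, l) * stack q b $ l)"
    using s B i
    by (simp add: lin_pred_def scalar_prod_def lessThan_atLeast0)
  also have "\<dots> = (\<Sum>l<sum d {1..q}. (?cs ! l) $ i * concat (map (\<lambda>k. list_of_vec (b k)) [1..<Suc q]) ! l)"
    unfolding block_cols_upto stack_upto vec_of_list_index
    using i len by (intro sum.cong refl) (simp add: mat_of_cols_index del: upt_Suc)
  also have "\<dots> = (\<Sum>k\<in>{1..q}. \<Sum>j<d k. (cols (X k) ! j) $ i * list_of_vec (b k) ! j)"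
    by (rule sum_concat_blocks) (use assms(1,2) in auto)
  also have "\<dots> = (\<Sum>k\<in>{1..q}. \<Sum>j<d k. b k $ j * X k $$ (i, j))"
  proof (intro sum.cong refl)
    fix k j assume "k \<in> {1..q}" "j \<in> {..<d k}"
    then show "cols (X k) ! j $ i * list_of_vec (b k) ! j = b k $ j * X k $$ (i, j)"
      using assms(1)[of k] i by (simp add: list_of_vec_index)
  qed
  finally show ?thesis unfolding fit_def .
qed

lemma lin_pred_dim: "dim_vec (lin_pred n q X b) = n"
  by (simp add: lin_pred_def block_cols_def)

lemma stack_surj:
  assumes v: "v \<in> carrier_vec (sum d {1..q})"
  obtains b where "\<And>k. b k \<in> carrier_vec (d k)" "stack q b = v"
proof
  define b where "b = (\<lambda>k. Matrix.vec (d k) (\<lambda>j. v $ (sum d {1..<k} + j)))"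
  show "b k \<in> carrier_vec (d k)" for k by (simp add: b_def)
  have "concat (map (\<lambda>k. map (\<lambda>j. v $ (sum d {1..<k} + j)) [0..<d k]) [1..<Suc q])
      = map (vec_index v) [0..<sum d {1..q}]" for q
  proof (induction q)
    case (Suc q)
    have "map (\<lambda>j. v $ (sum d {1..q} + j)) [0..<d (Suc q)]
        = map (vec_index v) [sum d {1..q}..<sum d {1..q} + d (Suc q)]"
      by (rule nth_equalityI) auto
    moreover have "[0..<sum d {1..Suc q}] = [0..<sum d {1..q}] @ [sum d {1..q}..<sum d {1..q} + d (Suc q)]"
      using upt_add_eq_append[of 0 "sum d {1..q}" "d (Suc q)"] by simp
    moreover have "[1..<Suc (Suc q)] = [1..<Suc q] @ [Suc q]" by simp
    ultimately show ?case
      using Suc.IH by (simp add: atLeastLessThanSuc_atLeastAtMost del: upt_Suc One_nat_def)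
  qed simp
  moreover have "list_of_vec (b k) = map (\<lambda>j. v $ (sum d {1..<k} + j)) [0..<d k]" for k
    by (rule nth_equalityI) (auto simp: b_def list_of_vec_index)
  ultimately have "stack q b = vec_of_list (map (vec_index v) [0..<sum d {1..q}])"
    by (simp add: stack_upto del: upt_Suc)
  also have "\<dots> = v" using v by (intro eq_vecI) (auto simp: vec_of_list_index)
  finally show "stack q b = v" .
qed

lemma fit_inner_lin_pred:
  assumes X: "\<And>k. k \<in> {1..q} \<Longrightarrow> X k \<in> carrier_mat n (d k)"
    and b: "\<And>k. k \<in> {1..q} \<Longrightarrow> b k \<in> carrier_vec (d k)" and c: "\<And>k. k \<in> {1..q} \<Longrightarrow> c k \<in> carrier_vec (d k)"
  shows "lin_pred n q X b \<bullet> lin_pred n q X c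
      = ip n (fit {1..q} d (\<lambda>k j i. X k $$ (i, j)) (\<lambda>k j. b k $ j))
          (fit {1..q} d (\<lambda>k j i. X k $$ (i, j)) (\<lambda>k j. c k $ j))"
  unfolding scalar_prod_def ip_def lin_pred_dim lessThan_atLeast0[symmetric]
  by (intro sum.cong refl arg_cong2[where f = "(*)"] lin_pred_index X b c) auto

text \<open>A lower bound on all eigenvalues bounds the quadratic form, because the infimum of the Rayleigh quotient is one of them.\<close>

lemma gram_coercive:
  fixes X :: "nat \<Rightarrow> real mat" and b :: "nat \<Rightarrow> nat \<Rightarrow> real"
  assumes n: "n \<ge> 1" and q: "q \<ge> 1" and X: "\<And>k. k \<in> {1..q} \<Longrightarrow> 1 \<le> d k \<and> X k \<in> carrier_mat n (d k)"
    and eig: "\<And>\<mu>. eigenvalue (Sigma_mat n X {1..q}) \<mu> \<Longrightarrow> c \<le> \<mu>"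
  defines "f \<equiv> fit {1..q} d (\<lambda>k j i. X k $$ (i, j)) b"
  shows "real n * c * (\<Sum>k\<in>{1..q}. (gnorm d b k)\<^sup>2) \<le> ip n f f"
proof -
  let ?B = "block_cols n X {1..q}" and ?m = "sum d {1..q}"
  let ?S = "Sigma_mat n X {1..q}"
  define bv where "bv = (\<lambda>k. Matrix.vec (d k) (b k))"
  have B: "?B \<in> carrier_mat n ?m" by (rule block_cols_carrier) (use X in auto)
  have S: "?S \<in> carrier_mat ?m ?m" using B by (simp add: Sigma_mat_def)
  have "d 1 \<le> ?m" using q by (intro member_le_sum) auto
  then have m: "?m > 0" using X[of 1] q by auto
  have sym: "transpose_mat ?S = ?S"
    unfolding Sigma_mat_def transpose_smult_mat
    using transpose_mult[of "transpose_mat ?B" ?m n ?B ?m] B by simp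
  obtain \<mu> where \<mu>: "eigenvalue ?S \<mu>" "\<And>x. x \<in> carrier_vec ?m \<Longrightarrow> \<mu> * (x \<bullet> x) \<le> x \<bullet> (?S *\<^sub>v x)"
    using symmetric_eigenvalue_Rayleigh[OF S sym m] by blast
  have bv: "bv k \<in> carrier_vec (d k)" for k by (simp add: bv_def)
  have sb: "stack q bv \<in> carrier_vec ?m" by (rule stack_carrier[OF bv])
  have bb: "stack q bv \<bullet> stack q bv = (\<Sum>k\<in>{1..q}. (gnorm d b k)\<^sup>2)"
    unfolding scalar_prod_stack[of q bv d bv, OF bv bv]
    by (simp add: bv_def L2_set_def sum_nonneg power2_eq_square)
  have "stack q bv \<bullet> (?S *\<^sub>v stack q bv) = 1 / real n * (stack q bv \<bullet> (transpose_mat ?B *\<^sub>v (?B *\<^sub>v stack q bv)))"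
    using B sb unfolding Sigma_mat_def
    by (subst smult_mat_mult_vec[of _ ?m ?m]) auto
  also have "stack q bv \<bullet> (transpose_mat ?B *\<^sub>v (?B *\<^sub>v stack q bv))
      = (?B *\<^sub>v stack q bv) \<bullet> (?B *\<^sub>v stack q bv)"
    using transpose_vec_mult_scalar[OF B sb, of "?B *\<^sub>v stack q bv"] B sb
    by (simp add: comm_scalar_prod[of "stack q bv" ?m])
  also have "\<dots> = lin_pred n q X bv \<bullet> lin_pred n q X bv" by (simp add: lin_pred_def)
  also have "\<dots> = ip n (fit {1..q} d (\<lambda>k j i. X k $$ (i, j)) (\<lambda>k j. bv k $ j)) (fit {1..q} d (\<lambda>k j i. X k $$ (i, j)) (\<lambda>k j. bv k $ j))"
    by (rule fit_inner_lin_pred) (use X bv in auto)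
  also have "\<dots> = ip n f f"
    unfolding f_def by (intro ip_cong fit_cong) (auto simp: bv_def)
  finally have "\<mu> * (stack q bv \<bullet> stack q bv) \<le> 1 / real n * ip n f f"
    using \<mu>(2)[OF sb] by simp
  moreover have "c * (stack q bv \<bullet> stack q bv) \<le> \<mu> * (stack q bv \<bullet> stack q bv)"
    using eig[OF \<mu>(1)] by (intro mult_right_mono scalar_prod_self_nonneg)
  ultimately have "c * (\<Sum>k\<in>{1..q}. (gnorm d b k)\<^sup>2) \<le> ip n f f / real n"
    unfolding bb by simp
  then show ?thesis using n by (simp add: pos_le_divide_eq mult_ac)
qed

text \<open>The normal equations in weak form, with arbitrary right-hand side \<open>e\<close>: an injective design has an invertible Gram matrix.\<close>

lemma gram_solvable:
  fixes X :: "nat \<Rightarrow> real mat" and e :: "nat \<Rightarrow> nat \<Rightarrow> real" and q :: nat and d :: "nat \<Rightarrow> nat"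
  defines "f \<equiv> fit {1..q} d (\<lambda>k j i. X k $$ (i, j))"
  assumes X: "\<And>k. k \<in> {1..q} \<Longrightarrow> X k \<in> carrier_mat n (d k)"
    and inj: "\<And>b k. ip n (f b) (f b) = 0 \<Longrightarrow> k \<in> {1..q} \<Longrightarrow> gnorm d b k = 0"
  obtains g where "\<And>b. ip n (f g) (f b) = (\<Sum>k\<in>{1..q}. \<Sum>j<d k. e k j * b k j)"
proof -
  let ?B = "block_cols n X {1..q}" and ?m = "sum d {1..q}"
  let ?G = "transpose_mat ?B * ?B"
  have B: "?B \<in> carrier_mat n ?m" by (rule block_cols_carrier) (use X in auto)
  have G: "?G \<in> carrier_mat ?m ?m" using B by simp
  have G_form: "(?G *\<^sub>v stack q b) \<bullet> stack q c = ip n (f (\<lambda>k j. b k $ j)) (f (\<lambda>k j. c k $ j))"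
    if bc: "\<And>k. b k \<in> carrier_vec (d k)" "\<And>k. c k \<in> carrier_vec (d k)" for b c
  proof -
    have s: "stack q b \<in> carrier_vec ?m" "stack q c \<in> carrier_vec ?m" by (rule stack_carrier[OF bc(1)], rule stack_carrier[OF bc(2)])
    have "(?G *\<^sub>v stack q b) \<bullet> stack q c = lin_pred n q X b \<bullet> lin_pred n q X c"
      using transpose_vec_mult_scalar[OF B s(2), of "?B *\<^sub>v stack q b"] B s
      by (simp add: lin_pred_def)
    then show ?thesis unfolding f_def by (subst (asm) fit_inner_lin_pred[of q X n d]) (use X bc in auto)
  qed
  have "Determinant.det ?G \<noteq> 0"
  proof
    assume "Determinant.det ?G = 0"
    then obtain v where v: "v \<in> carrier_vec ?m" "v \<noteq> 0\<^sub>v ?m" "?G *\<^sub>v v = 0\<^sub>v ?m"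
      using det_0_iff_vec_prod_zero_field[OF G] by auto
    obtain b where b: "\<And>k. b k \<in> carrier_vec (d k)" "stack q b = v"
      using stack_surj[OF v(1)] by blast
    have "ip n (f (\<lambda>k j. b k $ j)) (f (\<lambda>k j. b k $ j)) = 0"
      unfolding G_form[OF b(1) b(1), symmetric] using b(2) v by simp
    then have b0: "gnorm d (\<lambda>k j. b k $ j) k = 0" if "k \<in> {1..q}" for k using inj that by blast
    have "v \<bullet> v = (\<Sum>k\<in>{1..q}. \<Sum>j<d k. b k $ j * b k $ j)"
      unfolding b(2)[symmetric] by (rule scalar_prod_stack[OF b(1) b(1)])
    also have "\<dots> = 0"
      using b0 by (intro sum.neutral ballI) (simp add: L2_set_eq_0_iff)
    finally show False using scalar_prod_self_eq_0[OF v(1)] v(2) by simp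
  qed
  from det_non_zero_imp_unit[OF G this, of "()"] obtain N where
    N: "N \<in> carrier_mat ?m ?m" and GN: "?G * N = 1\<^sub>m ?m"
    by (auto simp: Units_def ring_mat_def)
  define ev where "ev = (\<lambda>k. Matrix.vec (d k) (e k))"
  have ev: "ev k \<in> carrier_vec (d k)" for k by (simp add: ev_def)
  have se: "stack q ev \<in> carrier_vec ?m" by (rule stack_carrier[OF ev])
  have "N *\<^sub>v stack q ev \<in> carrier_vec ?m" using N se by simp
  then obtain g where g: "\<And>k. g k \<in> carrier_vec (d k)" "stack q g = N *\<^sub>v stack q ev"
    using stack_surj by blast
  have Gg: "?G *\<^sub>v stack q g = stack q ev"
    unfolding g(2) using assoc_mult_mat_vec[OF G N se] GN se by simp
  show thesis
  proof
    fix b :: "nat \<Rightarrow> nat \<Rightarrow> real"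
    define bv where "bv = (\<lambda>k. Matrix.vec (d k) (b k))"
    have bv: "bv k \<in> carrier_vec (d k)" for k by (simp add: bv_def)
    have "ip n (f (\<lambda>k j. g k $ j)) (f b) = ip n (f (\<lambda>k j. g k $ j)) (f (\<lambda>k j. bv k $ j))"
      unfolding f_def by (intro ip_cong fit_cong refl) (simp add: bv_def)
    also have "\<dots> = stack q ev \<bullet> stack q bv"
      unfolding G_form[OF g(1) bv, symmetric] Gg ..
    also have "\<dots> = (\<Sum>k\<in>{1..q}. \<Sum>j<d k. e k j * b k j)"
      unfolding scalar_prod_stack[of q ev d bv, OF ev bv] by (simp add: ev_def bv_def)
    finally show "ip n (f (\<lambda>k j. g k $ j)) (f b) = (\<Sum>k\<in>{1..q}. \<Sum>j<d k. e k j * b k j)" .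
  qed
qed

section \<open>Gaussian linear forms\<close>

text \<open>A zero coefficient contributes a degenerate law, so normal laws are convolved over the indices with nonzero coefficient only.\<close>

lemma (in prob_space) Gaussian_linear_form:
  assumes \<sigma>: "0 < \<sigma>"
    and indep: "indep_vars (\<lambda>_. borel) err {..<n}"
    and normal: "\<And>i. i < n \<Longrightarrow> distributed M lborel (err i) (normal_density 0 \<sigma>)"
    and a: "0 < L2_set a {..<n}"
  shows "distributed M lborel (\<lambda>\<omega>. ip n (\<lambda>i. err i \<omega>) a) (normal_density 0 (\<sigma> * L2_set a {..<n}))"
proof -
  let ?I = "{i. i < n \<and> a i \<noteq> 0}"
  have I: "finite ?I" "?I \<subseteq> {..<n}" by auto
  have "?I \<noteq> {}"
  proof
    assume "?I = {}"
    then have "\<forall>i\<in>{..<n}. a i = 0" by blast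
    then have "L2_set a {..<n} = 0" by (rule L2_set_0')
    with a show False by simp
  qed
  have "indep_vars (\<lambda>_. borel) (\<lambda>i \<omega>. a i * err i \<omega>) ?I"
    by (rule indep_vars_compose2[OF indep_vars_subset[OF indep I(2)]]) simp
  moreover have "distributed M lborel (\<lambda>\<omega>. a i * err i \<omega>) (normal_density 0 (\<bar>a i\<bar> * \<sigma>))" if "i \<in> ?I" for i
    using normal_density_affine[OF normal \<sigma>, of i "a i" 0] that by simp
  ultimately have "distributed M lborel (\<lambda>\<omega>. \<Sum>i\<in>?I. a i * err i \<omega>)
      (normal_density (\<Sum>i\<in>?I. 0) (sqrt (\<Sum>i\<in>?I. (\<bar>a i\<bar> * \<sigma>)\<^sup>2)))"
    using I(1) \<open>?I \<noteq> {}\<close> \<sigma> by (intro sum_indep_normal) auto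
  moreover have "(\<Sum>i\<in>?I. a i * err i \<omega>) = ip n (\<lambda>i. err i \<omega>) a" for \<omega>
    unfolding ip_def by (subst mult.commute, rule sum.mono_neutral_left) auto
  moreover have "sqrt (\<Sum>i\<in>?I. (\<bar>a i\<bar> * \<sigma>)\<^sup>2) = \<sigma> * L2_set a {..<n}"
  proof -
    have "(\<Sum>i\<in>?I. (\<bar>a i\<bar> * \<sigma>)\<^sup>2) = (\<Sum>i<n. (\<bar>a i\<bar> * \<sigma>)\<^sup>2)"
      by (rule sum.mono_neutral_left) auto
    also have "sqrt \<dots> = L2_set (\<lambda>i. \<sigma> * \<bar>a i\<bar>) {..<n}"
      by (simp add: L2_set_def mult.commute)
    finally show ?thesis using \<sigma> by (simp add: L2_set_scale) (simp add: L2_set_def)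
  qed
  ultimately show ?thesis by simp
qed

lemma normal_density_times_exp_square:
  assumes "0 < \<tau>"
  shows "normal_density 0 \<tau> x * exp (x\<^sup>2 / (4 * \<tau>\<^sup>2)) = sqrt 2 * normal_density 0 (sqrt 2 * \<tau>) x"
proof -
  have "exp (- x\<^sup>2 / (2 * \<tau>\<^sup>2)) * exp (x\<^sup>2 / (4 * \<tau>\<^sup>2)) = exp (- x\<^sup>2 / (2 * (sqrt 2 * \<tau>)\<^sup>2))"
    unfolding exp_add[symmetric] using assms by (simp add: power_mult_distrib field_simps)
  moreover have "sqrt (2 * pi * (sqrt 2 * \<tau>)\<^sup>2) = sqrt 2 * sqrt (2 * pi * \<tau>\<^sup>2)"
    by (simp add: power_mult_distrib real_sqrt_mult)
  ultimately show ?thesis by (simp add: normal_density_def)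
qed

lemma nn_integral_normal_density: "0 < \<tau> \<Longrightarrow> (\<integral>\<^sup>+x. ennreal (normal_density \<mu> \<tau> x) \<partial>lborel) = 1"
  by (subst nn_integral_eq_integral) auto

text \<open>A single exponential moment of the square is enough for all tail bounds below.  The factor \<open>1/4\<close> halves the exponent of
the density, so that for \<open>s = \<tau>\<close> the integrand is a multiple of a normal density of twice the variance; a larger \<open>s\<close> only
decreases it.\<close>

lemma (in prob_space) Gaussian_exp_square:
  assumes W: "distributed M lborel W (normal_density 0 \<tau>)" and \<tau>: "0 < \<tau>" "\<tau> \<le> s"
  shows "(\<integral>\<^sup>+\<omega>. ennreal (exp ((W \<omega>)\<^sup>2 / (4 * s\<^sup>2))) \<partial>M) \<le> ennreal (sqrt 2)"
proof -
  have "(\<integral>\<^sup>+\<omega>. ennreal (exp ((W \<omega>)\<^sup>2 / (4 * s\<^sup>2))) \<partial>M)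
      = (\<integral>\<^sup>+x. ennreal (normal_density 0 \<tau> x) * ennreal (exp (x\<^sup>2 / (4 * s\<^sup>2))) \<partial>lborel)"
    by (rule distributed_nn_integral[OF W, symmetric]) simp
  also have "\<dots> \<le> (\<integral>\<^sup>+x. ennreal (sqrt 2) * ennreal (normal_density 0 (sqrt 2 * \<tau>) x) \<partial>lborel)"
  proof (rule nn_integral_mono)
    fix x :: real
    have "x\<^sup>2 / (4 * s\<^sup>2) \<le> x\<^sup>2 / (4 * \<tau>\<^sup>2)"
      using \<tau> by (intro divide_left_mono mult_left_mono power_mono) auto
    then have "normal_density 0 \<tau> x * exp (x\<^sup>2 / (4 * s\<^sup>2)) \<le> normal_density 0 \<tau> x * exp (x\<^sup>2 / (4 * \<tau>\<^sup>2))"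
      by (intro mult_left_mono) auto
    then show "ennreal (normal_density 0 \<tau> x) * ennreal (exp (x\<^sup>2 / (4 * s\<^sup>2)))
        \<le> ennreal (sqrt 2) * ennreal (normal_density 0 (sqrt 2 * \<tau>) x)"
      unfolding normal_density_times_exp_square[OF \<tau>(1)] by (simp add: ennreal_mult[symmetric] ennreal_leI)
  qed
  also have "\<dots> = ennreal (sqrt 2)"
    using \<tau> by (subst nn_integral_cmult) (auto simp: nn_integral_normal_density)
  finally show ?thesis .
qed

lemma (in prob_space) Gaussian_linear_form_exp_square:
  assumes \<sigma>: "0 < \<sigma>"
    and indep: "indep_vars (\<lambda>_. borel) err {..<n}"
    and normal: "\<And>i. i < n \<Longrightarrow> distributed M lborel (err i) (normal_density 0 \<sigma>)"
    and s: "\<sigma> * L2_set a {..<n} \<le> s"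
  shows "(\<integral>\<^sup>+\<omega>. ennreal (exp ((ip n (\<lambda>i. err i \<omega>) a)\<^sup>2 / (4 * s\<^sup>2))) \<partial>M) \<le> ennreal (sqrt 2)"
proof (cases "L2_set a {..<n} = 0")
  case True
  then have "a i = 0" if "i < n" for i using that by (simp add: L2_set_eq_0_iff)
  then have "ip n (\<lambda>i. err i \<omega>) a = 0" for \<omega> by (simp add: ip_def)
  then show ?thesis by (simp add: emeasure_space_1)
next
  case False
  then have a: "0 < L2_set a {..<n}" using L2_set_nonneg[of a "{..<n}"] by linarith
  show ?thesis
    using Gaussian_exp_square[OF Gaussian_linear_form[OF \<sigma> indep normal a] _ s] \<sigma> a by simp
qed

lemma (in prob_space) linear_form_measurable:
  assumes "\<And>i. i < n \<Longrightarrow> distributed M lborel (err i) (normal_density 0 \<sigma>)"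
  shows "(\<lambda>\<omega>. ip n (\<lambda>i. err i \<omega>) a) \<in> borel_measurable M"
proof -
  have "err i \<in> borel_measurable M" if "i < n" for i
    using distributed_measurable[OF assms[OF that]] by simp
  then show ?thesis unfolding ip_def by (intro borel_measurable_sum borel_measurable_times) auto
qed

text \<open>The \<open>D\<close> forms may be arbitrarily correlated.  Convexity of \<open>exp\<close> bounds the exponential of the mean of the squares by the mean
of the exponentials, so the scaled norm obeys the tail bound of a single form and no union over the \<open>D\<close> coordinates is
needed.\<close>

lemma (in prob_space) Gaussian_group_tail:
  assumes \<sigma>: "0 < \<sigma>"
    and indep: "indep_vars (\<lambda>_. borel) err {..<n}"
    and normal: "\<And>i. i < n \<Longrightarrow> distributed M lborel (err i) (normal_density 0 \<sigma>)"
    and s: "\<And>j. j < D \<Longrightarrow> \<sigma> * L2_set (a j) {..<n} \<le> s"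
    and D: "1 \<le> D" and s0: "0 < s" and t: "0 \<le> t"
  shows "prob {\<omega>\<in>space M. t * sqrt (real D) \<le> L2_set (\<lambda>j. ip n (\<lambda>i. err i \<omega>) (a j)) {..<D}}
      \<le> sqrt 2 * exp (- (t\<^sup>2 / (4 * s\<^sup>2)))"
proof -
  define W where "W = (\<lambda>j \<omega>. ip n (\<lambda>i. err i \<omega>) (a j))"
  have W[measurable]: "W j \<in> borel_measurable M" for j
    unfolding W_def by (rule linear_form_measurable[OF normal])
  define u where "u = (\<lambda>\<omega>. exp (\<Sum>j<D. 1 / real D * ((W j \<omega>)\<^sup>2 / (4 * s\<^sup>2))))"
  have u[measurable]: "u \<in> borel_measurable M" unfolding u_def by measurable
  let ?c = "exp (- (t\<^sup>2 / (4 * s\<^sup>2)))"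
  let ?E = "{\<omega>\<in>space M. t * sqrt (real D) \<le> L2_set (\<lambda>j. W j \<omega>) {..<D}}"
  have sub: "?E \<subseteq> {\<omega>\<in>space M. 1 \<le> ennreal ?c * ennreal (u \<omega>)}"
  proof
    fix \<omega> assume \<omega>: "\<omega> \<in> ?E"
    have "(t * sqrt (real D))\<^sup>2 \<le> (L2_set (\<lambda>j. W j \<omega>) {..<D})\<^sup>2"
      using \<omega> t by (intro power_mono) auto
    then have "t\<^sup>2 * real D \<le> (\<Sum>j<D. (W j \<omega>)\<^sup>2)"
      by (simp add: power_mult_distrib L2_set_def sum_nonneg)
    then have "t\<^sup>2 / (4 * s\<^sup>2) \<le> (\<Sum>j<D. (W j \<omega>)\<^sup>2) / real D / (4 * s\<^sup>2)"
      using D s0 by (intro divide_right_mono) (auto simp: field_simps)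
    also have "\<dots> = (\<Sum>j<D. 1 / real D * ((W j \<omega>)\<^sup>2 / (4 * s\<^sup>2)))"
      by (simp add: sum_divide_distrib)
    finally have "1 \<le> ?c * u \<omega>" unfolding u_def exp_add[symmetric] by simp
    then have "ennreal 1 \<le> ennreal (?c * u \<omega>)" by (rule ennreal_leI)
    then show "\<omega> \<in> {\<omega>\<in>space M. 1 \<le> ennreal ?c * ennreal (u \<omega>)}"
      using \<omega> by (simp add: ennreal_mult' u_def)
  qed
  have "(\<integral>\<^sup>+\<omega>. ennreal (u \<omega>) \<partial>M) \<le> (\<integral>\<^sup>+\<omega>. (\<Sum>j<D. ennreal (1 / real D) * ennreal (exp ((W j \<omega>)\<^sup>2 / (4 * s\<^sup>2)))) \<partial>M)"
  proof (rule nn_integral_mono)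
    fix \<omega>
    have "{..<D} \<noteq> {}" using D by (auto simp: lessThan_empty_iff)
    then have "u \<omega> \<le> (\<Sum>j<D. 1 / real D * exp ((W j \<omega>)\<^sup>2 / (4 * s\<^sup>2)))"
      using convex_on_sum[of "{..<D}" UNIV exp "\<lambda>_. 1 / real D" "\<lambda>j. (W j \<omega>)\<^sup>2 / (4 * s\<^sup>2)"] D
      by (auto simp: u_def exp_convex)
    then show "ennreal (u \<omega>) \<le> (\<Sum>j<D. ennreal (1 / real D) * ennreal (exp ((W j \<omega>)\<^sup>2 / (4 * s\<^sup>2))))"
      by (simp add: ennreal_mult[symmetric] sum_ennreal ennreal_leI)
  qed
  also have "\<dots> = (\<Sum>j<D. ennreal (1 / real D) * (\<integral>\<^sup>+\<omega>. ennreal (exp ((W j \<omega>)\<^sup>2 / (4 * s\<^sup>2))) \<partial>M))"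
    by (subst nn_integral_sum) (auto simp: nn_integral_cmult)
  also have "\<dots> \<le> (\<Sum>j<D. ennreal (1 / real D) * ennreal (sqrt 2))"
    unfolding W_def
    by (intro sum_mono mult_left_mono Gaussian_linear_form_exp_square[OF \<sigma> indep normal]) (use s in auto)
  also have "\<dots> = (\<Sum>j<D. ennreal (1 / real D * sqrt 2))"
    by (intro sum.cong refl ennreal_mult[symmetric]) auto
  also have "\<dots> = ennreal (\<Sum>j<D. 1 / real D * sqrt 2)"
    by (rule sum_ennreal) simp
  also have "(\<Sum>j<D. 1 / real D * sqrt 2) = sqrt 2" using D by simp
  finally have int: "(\<integral>\<^sup>+\<omega>. ennreal (u \<omega>) \<partial>M) \<le> ennreal (sqrt 2)" .
  have "emeasure M ?E \<le> emeasure M {\<omega>\<in>space M. 1 \<le> ennreal ?c * ennreal (u \<omega>)}"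
    by (rule emeasure_mono[OF sub]) measurable
  also have "\<dots> \<le> ennreal ?c * (\<integral>\<^sup>+\<omega>. ennreal (u \<omega>) * indicator (space M) \<omega> \<partial>M)"
    by (rule nn_integral_Markov_inequality) auto
  also have "(\<integral>\<^sup>+\<omega>. ennreal (u \<omega>) * indicator (space M) \<omega> \<partial>M) = (\<integral>\<^sup>+\<omega>. ennreal (u \<omega>) \<partial>M)"
    by (rule nn_integral_cong) simp
  also have "ennreal ?c * (\<integral>\<^sup>+\<omega>. ennreal (u \<omega>) \<partial>M) \<le> ennreal ?c * ennreal (sqrt 2)"
    by (rule mult_left_mono[OF int]) simp
  also have "\<dots> = ennreal (sqrt 2 * ?c)" by (simp add: ennreal_mult[symmetric] mult.commute)
  finally have "prob ?E \<le> sqrt 2 * ?c" by (simp add: emeasure_eq_measure)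
  then show ?thesis unfolding W_def .
qed

text \<open>The density is at most \<open>1 / (sqrt (2 * pi) * \<tau>)\<close>, which is below \<open>1 / (2 * \<tau>)\<close>, and the interval has length \<open>2 * \<eta>\<close>.\<close>

lemma (in prob_space) Gaussian_anticoncentration:
  assumes W: "distributed M lborel W (normal_density 0 \<tau>)" and \<tau>: "0 < \<tau>" and \<eta>: "0 \<le> \<eta>"
  shows "prob {\<omega>\<in>space M. \<bar>W \<omega> + \<theta>\<bar> \<le> \<eta>} \<le> \<eta> / \<tau>"
proof -
  let ?J = "{- \<theta> - \<eta>..- \<theta> + \<eta>}"
  let ?c = "1 / (2 * \<tau>)"
  have "{\<omega>\<in>space M. \<bar>W \<omega> + \<theta>\<bar> \<le> \<eta>} = W -` ?J \<inter> space M" by auto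
  then have "emeasure M {\<omega>\<in>space M. \<bar>W \<omega> + \<theta>\<bar> \<le> \<eta>} = (\<integral>\<^sup>+x. ennreal (normal_density 0 \<tau> x) * indicator ?J x \<partial>lborel)"
    using distributed_emeasure[OF W, of ?J] by simp
  also have "\<dots> \<le> (\<integral>\<^sup>+x. ennreal ?c * indicator ?J x \<partial>lborel)"
  proof (intro nn_integral_mono mult_right_mono ennreal_leI)
    fix x :: real
    have "2 * \<tau> = sqrt (4 * \<tau>\<^sup>2)" using \<tau> by (simp add: real_sqrt_mult)
    also have "\<dots> \<le> sqrt (2 * pi * \<tau>\<^sup>2)"
      using pi_ge_two by (intro real_sqrt_le_mono mult_right_mono) auto
    finally have "1 / sqrt (2 * pi * \<tau>\<^sup>2) \<le> ?c" using \<tau> by (intro divide_left_mono) auto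
    then have "1 / sqrt (2 * pi * \<tau>\<^sup>2) * exp (- (x - 0)\<^sup>2 / (2 * \<tau>\<^sup>2)) \<le> ?c * 1"
      using \<tau> by (intro mult_mono) auto
    then show "normal_density 0 \<tau> x \<le> ?c" by (simp add: normal_density_def)
  qed auto
  also have "\<dots> = ennreal ?c * ennreal (2 * \<eta>)"
    using \<eta> by (subst nn_integral_cmult_indicator) auto
  also have "\<dots> = ennreal (\<eta> / \<tau>)" using \<tau> \<eta> by (simp add: ennreal_mult[symmetric])
  finally show ?thesis using \<tau> \<eta> by (simp add: emeasure_eq_measure)
qed

section \<open>Selection at a fixed sample size\<close>

lemma l2_eq_L2_set: "v \<in> carrier_vec m \<Longrightarrow> l2 v = L2_set (vec_index v) {..<m}"
  by (auto simp: l2_def L2_set_def scalar_prod_def power2_eq_square lessThan_atLeast0)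

lemma l2_nonneg: "0 \<le> l2 v"
  by (simp add: l2_def scalar_prod_self_nonneg)

lemma l2_col:
  assumes "A \<in> carrier_mat n m" "j < m"
  shows "(l2 (col A j))\<^sup>2 = ip n (\<lambda>i. A $$ (i, j)) (\<lambda>i. A $$ (i, j))"
  using assms l2_eq_L2_set[of "col A j" n]
  by (auto simp: ip_self intro!: arg_cong[where f = "\<lambda>t. t\<^sup>2"] L2_set_cong)

text \<open>A group with vanishing initial estimate has weight \<open>\<infinity>\<close>, and \<open>\<infinity> * 0 = 0\<close>; hence the objective is a real number at coefficients that
vanish on those groups.\<close>

lemma agl_objective_finite:
  fixes X :: "nat \<Rightarrow> real mat" and p :: nat and d :: "nat \<Rightarrow> nat"
  assumes X: "\<And>k. k \<in> {1..p} \<Longrightarrow> X k \<in> carrier_mat n (d k)"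
    and y: "y \<in> carrier_vec n" and b: "\<And>k. k \<in> {1..p} \<Longrightarrow> b k \<in> carrier_vec (d k)"
    and F: "F = {k \<in> {1..p}. l2 (bt k) \<noteq> 0}"
    and b0: "\<And>k j. k \<in> {1..p} - F \<Longrightarrow> j < d k \<Longrightarrow> b k $ j = 0"
  defines "u \<equiv> \<lambda>i. y $ i - fit {1..p} d (\<lambda>k j i. X k $$ (i, j)) (\<lambda>k j. b k $ j) i"
  shows "agl_objective n p d X y lam bt b
    = ereal (1/2 * ip n u u + (\<Sum>k\<in>F. lam * sqrt (d k) / l2 (bt k) * gnorm d (\<lambda>k j. b k $ j) k))"
proof -
  have fit: "(y - lin_pred n p X b) \<bullet> (y - lin_pred n p X b) = ip n u u"
    unfolding scalar_prod_def ip_def u_def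
    using y lin_pred_index[of p X n d b] X b
    by (auto simp: lin_pred_dim lessThan_atLeast0 intro!: sum.cong)
  have "(\<Sum>k\<in>{1..p}. inverse (ereal (l2 (bt k))) * ereal (sqrt (real (d k)) * l2 (b k)))
      = (\<Sum>k\<in>{1..p}. ereal (if k \<in> F then sqrt (d k) / l2 (bt k) * gnorm d (\<lambda>k j. b k $ j) k else 0))"
  proof (rule sum.cong[OF refl])
    fix k assume k: "k \<in> {1..p}"
    have l2b: "l2 (b k) = gnorm d (\<lambda>k j. b k $ j) k" using l2_eq_L2_set[OF b[OF k]] by simp
    show "inverse (ereal (l2 (bt k))) * ereal (sqrt (real (d k)) * l2 (b k))
        = ereal (if k \<in> F then sqrt (d k) / l2 (bt k) * gnorm d (\<lambda>k j. b k $ j) k else 0)"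
    proof (cases "k \<in> F")
      case True
      then have "l2 (bt k) \<noteq> 0" using F by simp
      then show ?thesis using True l2b by (simp add: divide_inverse mult_ac)
    next
      case False
      then have "l2 (bt k) = 0" "l2 (b k) = 0"
        using F k b0[of k] unfolding l2b by (auto simp: L2_set_def)
      then show ?thesis using False by simp
    qed
  qed
  also have "\<dots> = ereal (\<Sum>k\<in>F. sqrt (d k) / l2 (bt k) * gnorm d (\<lambda>k j. b k $ j) k)"
  proof -
    have "F \<subseteq> {1..p}" using F by auto
    then have "(\<Sum>k\<in>{1..p}. if k \<in> F then sqrt (d k) / l2 (bt k) * gnorm d (\<lambda>k j. b k $ j) k else 0)
        = (\<Sum>k\<in>F. sqrt (d k) / l2 (bt k) * gnorm d (\<lambda>k j. b k $ j) k)"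
      by (simp add: sum.If_cases Int_absorb1)
    then show ?thesis by (simp only: sum_ereal)
  qed
  finally show ?thesis
    unfolding agl_objective_def fit by (simp add: sum_distrib_left mult_ac)
qed

lemma lasso_variational_inequality:
  fixes X :: "nat \<Rightarrow> real mat" and p :: nat and d :: "nat \<Rightarrow> nat"
  assumes X: "\<And>k. k \<in> {1..p} \<Longrightarrow> X k \<in> carrier_mat n (d k)"
    and y: "y \<in> carrier_vec n" and lam: "0 \<le> lam"
    and lasso: "is_adaptive_group_lasso n p d X y lam bt bh"
    and F: "F = {k \<in> {1..p}. l2 (bt k) \<noteq> 0}"
  defines "f \<equiv> fit {1..p} d (\<lambda>k j i. X k $$ (i, j))" and "h \<equiv> \<lambda>k j. bh k $ j"
  shows "\<And>k j. k \<in> {1..p} - F \<Longrightarrow> j < d k \<Longrightarrow> h k j = 0"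
    and "\<And>\<gamma>. (\<And>k j. k \<in> {1..p} - F \<Longrightarrow> j < d k \<Longrightarrow> \<gamma> k j = 0) \<Longrightarrow>
      ip n (\<lambda>i. y $ i - f h i) (f \<gamma>)
      \<le> (\<Sum>k\<in>F. lam * sqrt (d k) / l2 (bt k) * (L2_set (\<lambda>j. h k j + \<gamma> k j) {..<d k} - gnorm d h k))"
proof -
  have bh: "\<And>k. k \<in> {1..p} \<Longrightarrow> bh k \<in> carrier_vec (d k)"
    and bh0: "\<And>k. k \<in> {1..p} \<Longrightarrow> l2 (bt k) = 0 \<Longrightarrow> bh k = 0\<^sub>v (d k)"
    and min: "\<And>b. (\<And>k. k \<in> {1..p} \<Longrightarrow> b k \<in> carrier_vec (d k)) \<Longrightarrow>
        agl_objective n p d X y lam bt bh \<le> agl_objective n p d X y lam bt b"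
    using lasso unfolding is_adaptive_group_lasso_def by auto
  show h0: "h k j = 0" if "k \<in> {1..p} - F" "j < d k" for k j
    using that bh0[of k] F by (auto simp: h_def)
  fix \<gamma> :: "nat \<Rightarrow> nat \<Rightarrow> real" assume \<gamma>: "\<And>k j. k \<in> {1..p} - F \<Longrightarrow> j < d k \<Longrightarrow> \<gamma> k j = 0"
  show "ip n (\<lambda>i. y $ i - f h i) (f \<gamma>)
      \<le> (\<Sum>k\<in>F. lam * sqrt (d k) / l2 (bt k) * (L2_set (\<lambda>j. h k j + \<gamma> k j) {..<d k} - gnorm d h k))"
    unfolding f_def
  proof (rule variational_inequality[OF _ h0 _ \<gamma>])
    show "0 \<le> lam * sqrt (d k) / l2 (bt k)" for k using lam by (simp add: l2_nonneg)
    fix b :: "nat \<Rightarrow> nat \<Rightarrow> real" assume b0: "\<And>k j. k \<in> {1..p} - F \<Longrightarrow> j < d k \<Longrightarrow> b k j = 0"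
    define bv where "bv = (\<lambda>k. Matrix.vec (d k) (b k))"
    let ?x = "\<lambda>k j i. X k $$ (i, j)"
    have bv: "bv k \<in> carrier_vec (d k)" for k by (simp add: bv_def)
    have fit_bv: "fit {1..p} d ?x (\<lambda>k j. bv k $ j) i = fit {1..p} d ?x b i" for i
      by (rule fit_cong) (simp add: bv_def)
    have gn_bv: "gnorm d (\<lambda>k j. bv k $ j) k = gnorm d b k" for k
      by (rule L2_set_cong) (auto simp: bv_def)
    have bv0: "bv k $ j = 0" if "k \<in> {1..p} - F" "j < d k" for k j
      using b0[OF that] that by (simp add: bv_def)
    show "1/2 * ip n (\<lambda>i. y $ i - fit {1..p} d ?x h i) (\<lambda>i. y $ i - fit {1..p} d ?x h i)
          + (\<Sum>k\<in>F. lam * sqrt (d k) / l2 (bt k) * gnorm d h k)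
        \<le> 1/2 * ip n (\<lambda>i. y $ i - fit {1..p} d ?x b i) (\<lambda>i. y $ i - fit {1..p} d ?x b i)
          + (\<Sum>k\<in>F. lam * sqrt (d k) / l2 (bt k) * gnorm d b k)"
      using min[of bv, OF bv] agl_objective_finite[where b = bh and d = d and X = X and lam = lam, OF X y bh F]
        agl_objective_finite[where b = bv and d = d and X = X and lam = lam, OF X y bv F] h0 bv0
      unfolding fit_bv gn_bv by (simp add: h_def)
  qed
qed

lemma sum_gnorm_le:
  assumes c: "0 < c" and n: "1 \<le> n"
    and coer: "real n * c * (\<Sum>k\<in>{1..q}. (gnorm d g k)\<^sup>2) \<le> w\<^sup>2" and w: "0 \<le> w"
  shows "(\<Sum>k\<in>{1..q}. gnorm d g k) \<le> sqrt (real q) * (w / sqrt (real n * c))"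
proof -
  have nc: "0 < real n * c" using n c by simp
  have "(\<Sum>k\<in>{1..q}. \<bar>gnorm d g k\<bar> * \<bar>1\<bar>) \<le> L2_set (gnorm d g) {1..q} * L2_set (\<lambda>_. 1) {1..q}"
    by (rule L2_set_mult_ineq)
  also have "\<dots> = sqrt (real q) * L2_set (gnorm d g) {1..q}" by (simp add: L2_set_constant)
  also have "L2_set (gnorm d g) {1..q} \<le> sqrt (w\<^sup>2 / (real n * c))"
    unfolding L2_set_def[of "gnorm d g"] using coer nc
    by (intro real_sqrt_le_mono) (simp add: pos_le_divide_eq mult_ac)
  also have "sqrt (w\<^sup>2 / (real n * c)) = w / sqrt (real n * c)" using w by (simp add: real_sqrt_divide)
  finally show ?thesis by (simp add: L2_set_nonneg mult_left_mono)
qed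

lemma coercive_imp_zero:
  assumes n: "1 \<le> n" and c: "0 < c"
    and le: "real n * c * (\<Sum>k\<in>{1..q}. (gnorm d b k)\<^sup>2) \<le> 0" and k: "k \<in> {1..q}"
  shows "gnorm d b k = 0"
proof -
  have "(\<Sum>k\<in>{1..q}. (gnorm d b k)\<^sup>2) \<le> 0"
    using le n c by (simp add: mult_le_0_iff)
  moreover have "(gnorm d b k)\<^sup>2 \<le> (\<Sum>k\<in>{1..q}. (gnorm d b k)\<^sup>2)"
    using k by (intro member_le_sum) auto
  ultimately have "(gnorm d b k)\<^sup>2 \<le> 0" by linarith
  then show ?thesis by simp
qed

text \<open>The residual of \<open>v\<close> after projection on the signal columns is no longer than \<open>v\<close>.  Coercivity bounds the coefficients by the
projection, and Cauchy-Schwarz over the \<open>q\<close> groups turns the Euclidean bound into one for the sum of group norms.\<close>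

lemma regression_residual:
  fixes X :: "nat \<Rightarrow> real mat" and v :: "nat \<Rightarrow> real" and q :: nat and d :: "nat \<Rightarrow> nat"
  defines "f \<equiv> fit {1..q} d (\<lambda>k j i. X k $$ (i, j))"
  assumes n: "1 \<le> n" and c: "0 < c" and X: "\<And>k. k \<in> {1..q} \<Longrightarrow> X k \<in> carrier_mat n (d k)"
    and coer: "\<And>b. real n * c * (\<Sum>k\<in>{1..q}. (gnorm d b k)\<^sup>2) \<le> ip n (f b) (f b)"
    and v: "ip n v v \<le> C * real n"
  obtains g where "\<And>b. ip n (\<lambda>i. v i - f g i) (f b) = 0"
    "L2_set (\<lambda>i. v i - f g i) {..<n} \<le> sqrt (C * real n)"
    "(\<Sum>k\<in>{1..q}. gnorm d g k) \<le> sqrt (real q * C / c)"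
proof -
  have inj: "gnorm d b k = 0" if "ip n (f b) (f b) = 0" "k \<in> {1..q}" for b k
    using coercive_imp_zero[where d = d and b = b, OF n c _ that(2)] coer[of b] that(1) by simp
  obtain g where g: "\<And>b. ip n (f g) (f b) = (\<Sum>k\<in>{1..q}. \<Sum>j<d k. ip n v (\<lambda>i. X k $$ (i, j)) * b k j)"
    using gram_solvable[of q X n d "\<lambda>k j. ip n v (\<lambda>i. X k $$ (i, j))"] X inj unfolding f_def by blast
  have g': "ip n (f g) (f b) = ip n v (f b)" for b
    unfolding g by (simp add: f_def ip_fit_right mult.commute)
  have orth: "ip n (\<lambda>i. v i - f g i) (f b) = 0" for b by (simp add: ip_diff_left g')
  let ?r = "\<lambda>i. v i - f g i"
  have "ip n v v = ip n (\<lambda>i. ?r i + f g i) (\<lambda>i. ?r i + f g i)" by simp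
  also have "\<dots> = ip n ?r ?r + ip n (f g) (f g)"
    unfolding ip_add_left ip_commute[of n _ "\<lambda>i. ?r i + f g i"]
    using orth[of g] ip_commute[of n "f g" ?r] by simp
  finally have py: "ip n ?r ?r + ip n (f g) (f g) \<le> C * real n" using v by simp
  have nn: "0 \<le> ip n u u" for u by (simp add: ip_self)
  have r: "L2_set ?r {..<n} \<le> sqrt (C * real n)"
  proof (rule real_le_rsqrt)
    show "(L2_set ?r {..<n})\<^sup>2 \<le> C * real n"
      unfolding ip_self[symmetric] using py nn[of "f g"] by linarith
  qed
  have "0 \<le> C * real n" using py nn[of ?r] nn[of "f g"] by linarith
  then have C: "0 \<le> C" using n by (simp add: zero_le_mult_iff)
  have "ip n (f g) (f g) \<le> (sqrt (C * real n))\<^sup>2" using py nn[of ?r] C by simp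
  then have "(\<Sum>k\<in>{1..q}. gnorm d g k) \<le> sqrt (real q) * (sqrt (C * real n) / sqrt (real n * c))"
    using coer[of g] C by (intro sum_gnorm_le[OF c n]) auto
  also have "\<dots> = sqrt (real q * C / c)"
    using n by (simp add: real_sqrt_mult real_sqrt_divide)
  finally show thesis using that[OF orth r] by blast
qed

text \<open>With \<open>w = |f g|\<close>, the normal equations tested at \<open>g\<close> give \<open>w^2 \<le> |g_k0| \<le> w / sqrt (n * c)\<close>, which is the upper bound.
Tested at \<open>u\<close> itself they give \<open>1 \<le> w * |X_k0 u|\<close>, and the column bound gives the lower one.  The upper bound controls the tail
of the Gaussian variable \<open>\<langle>err, f g\<rangle>\<close>, the lower bound its density.\<close>

lemma signal_direction:
  fixes X :: "nat \<Rightarrow> real mat" and u :: "nat \<Rightarrow> real" and q :: nat and d :: "nat \<Rightarrow> nat"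
  defines "f \<equiv> fit {1..q} d (\<lambda>k j i. X k $$ (i, j))"
  assumes n: "1 \<le> n" and c: "0 < c" and X: "\<And>k. k \<in> {1..q} \<Longrightarrow> X k \<in> carrier_mat n (d k)"
    and coer: "\<And>b. real n * c * (\<Sum>k\<in>{1..q}. (gnorm d b k)\<^sup>2) \<le> ip n (f b) (f b)"
    and col: "\<And>j. j < d k0 \<Longrightarrow> L2_set (\<lambda>i. X k0 $$ (i, j)) {..<n} \<le> sqrt (C * real n)"
    and k0: "k0 \<in> {1..q}" and u: "L2_set u {..<d k0} = 1" and C: "0 < C"
  obtains g where "\<And>b. ip n (f g) (f b) = (\<Sum>j<d k0. u j * b k0 j)"
    "L2_set (f g) {..<n} \<le> 1 / sqrt (real n * c)"
    "1 / sqrt (real n * C * real (d k0)) \<le> L2_set (f g) {..<n}"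
    "(\<Sum>k\<in>{1..q}. gnorm d g k) \<le> sqrt (real q) / (real n * c)"
proof -
  have nc: "0 < real n * c" using n c by simp
  have inj: "gnorm d b k = 0" if "ip n (f b) (f b) = 0" "k \<in> {1..q}" for b k
    using coercive_imp_zero[where d = d and b = b, OF n c _ that(2)] coer[of b] that(1) by simp
  obtain g where g: "\<And>b. ip n (f g) (f b) = (\<Sum>k\<in>{1..q}. \<Sum>j<d k. (if k = k0 then u j else 0) * b k j)"
    using gram_solvable[of q X n d "\<lambda>k j. if k = k0 then u j else 0"] X inj unfolding f_def by blast
  have g': "ip n (f g) (f b) = (\<Sum>j<d k0. u j * b k0 j)" for b
  proof -
    have "(\<Sum>k\<in>{1..q}. \<Sum>j<d k. (if k = k0 then u j else 0) * b k j)
        = (\<Sum>k\<in>{1..q}. if k = k0 then \<Sum>j<d k0. u j * b k0 j else 0)"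
      by (intro sum.cong refl) auto
    then show ?thesis unfolding g using k0 by simp
  qed
  define w where "w = L2_set (f g) {..<n}"
  have w0: "0 \<le> w" by (simp add: w_def L2_set_nonneg)
  have ww: "ip n (f g) (f g) = w\<^sup>2" by (simp add: ip_self w_def)
  have "w\<^sup>2 \<le> gnorm d g k0"
    unfolding ww[symmetric] g' using ip_le_L2[of u "g k0" "{..<d k0}"] u by simp
  moreover have "gnorm d g k0 \<le> w / sqrt (real n * c)"
  proof -
    have "real n * c * (gnorm d g k0)\<^sup>2 \<le> real n * c * (\<Sum>k\<in>{1..q}. (gnorm d g k)\<^sup>2)"
      using nc k0 by (intro mult_left_mono member_le_sum) auto
    then have "(gnorm d g k0)\<^sup>2 \<le> w\<^sup>2 / (real n * c)"
      using coer[of g] nc by (simp add: ww pos_le_divide_eq mult_ac)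
    then have "gnorm d g k0 \<le> sqrt (w\<^sup>2 / (real n * c))" by (rule real_le_rsqrt)
    then show ?thesis using w0 by (simp add: real_sqrt_divide)
  qed
  ultimately have "w * w \<le> w * (1 / sqrt (real n * c))" by (simp add: power2_eq_square)
  then have w1: "w \<le> 1 / sqrt (real n * c)"
    using w0 nc mult_left_le_imp_le[of w w "1 / sqrt (real n * c)"] by (cases "w = 0") auto
  have low: "1 / sqrt (real n * C * real (d k0)) \<le> w"
  proof -
    define b where "b = (\<lambda>k j. if k = k0 then u j else 0 :: real)"
    have fb: "f b i = (\<Sum>j<d k0. u j * X k0 $$ (i, j))" for i
    proof -
      have "f b i = (\<Sum>k\<in>{1..q}. if k = k0 then \<Sum>j<d k0. u j * X k0 $$ (i, j) else 0)"
        unfolding f_def fit_def b_def by (intro sum.cong refl) auto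
      then show ?thesis using k0 by simp
    qed
    have "1 = (L2_set u {..<d k0})\<^sup>2" using u by simp
    also have "\<dots> = (\<Sum>j<d k0. u j * b k0 j)"
      by (simp add: L2_set_def b_def sum_nonneg power2_eq_square)
    also have "\<dots> = ip n (f g) (f b)" by (simp add: g')
    also have "\<dots> \<le> w * L2_set (f b) {..<n}"
      using ip_le_L2[of "f g" "f b" "{..<n}"] by (simp add: ip_def w_def)
    also have "L2_set (f b) {..<n} \<le> (\<Sum>j<d k0. L2_set (\<lambda>i. u j * X k0 $$ (i, j)) {..<n})"
      unfolding fb[abs_def] by (rule L2_set_sum_le) simp
    also have "\<dots> \<le> (\<Sum>j<d k0. \<bar>u j\<bar> * sqrt (C * real n))"
      unfolding L2_set_scale using col by (intro sum_mono mult_left_mono) auto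
    also have "\<dots> = (\<Sum>j<d k0. \<bar>u j\<bar> * \<bar>1\<bar>) * sqrt (C * real n)" by (simp add: sum_distrib_right)
    also have "\<dots> \<le> (L2_set u {..<d k0} * L2_set (\<lambda>_. 1) {..<d k0}) * sqrt (C * real n)"
      using C by (intro mult_right_mono L2_set_mult_ineq) auto
    also have "\<dots> = sqrt (real n * C * real (d k0))" using u by (simp add: L2_set_constant real_sqrt_mult)
    finally have 1: "1 \<le> w * sqrt (real n * C * real (d k0))" using w0 by (simp add: mult_left_mono)
    then have "0 < sqrt (real n * C * real (d k0))" using w0
      by (metis linorder_not_less mult_nonneg_nonpos not_one_le_zero order_trans)
    with 1 show ?thesis by (simp add: pos_divide_le_eq)
  qed
  have "(\<Sum>k\<in>{1..q}. gnorm d g k) \<le> sqrt (real q) * (w / sqrt (real n * c))"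
    using coer[of g] w0 by (intro sum_gnorm_le[OF c n]) (auto simp: ww)
  also have "\<dots> \<le> sqrt (real q) * ((1 / sqrt (real n * c)) / sqrt (real n * c))"
    using w1 nc by (intro mult_left_mono divide_right_mono) auto
  also have "\<dots> = sqrt (real q) / (sqrt (real n * c) * sqrt (real n * c))" by simp
  also have "sqrt (real n * c) * sqrt (real n * c) = real n * c" using nc by simp
  finally have "(\<Sum>k\<in>{1..q}. gnorm d g k) \<le> sqrt (real q) / (real n * c)" .
  with g' w1 low show thesis using that unfolding w_def by blast
qed

text \<open>All deterministic information about one sample size.  The vectors \<open>r k j\<close> (residuals of the null columns) and \<open>w k\<close> (one test
direction per signal group) depend on the design and on \<open>\<beta>\<close>, but not on the noise or on the initial estimate.  This order of
quantifiers is what makes \<open>ip n \<epsilon> (r k j)\<close> and \<open>ip n \<epsilon> (w k)\<close> Gaussian although the weights are random and may depend on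
the noise.\<close>

lemma adaptive_lasso_selects:
  fixes X :: "nat \<Rightarrow> real mat" and \<beta> :: "nat \<Rightarrow> real Matrix.vec" and c C :: real and p q :: nat and d :: "nat \<Rightarrow> nat"
  assumes n: "1 \<le> n" and q: "1 \<le> q" "q \<le> p" and c: "0 < c" and C: "0 < C"
    and dims: "\<And>k. k \<in> {1..p} \<Longrightarrow> 1 \<le> d k \<and> X k \<in> carrier_mat n (d k) \<and> \<beta> k \<in> carrier_vec (d k)"
    and col: "\<And>k j. k \<in> {1..p} \<Longrightarrow> j < d k \<Longrightarrow> (l2 (col (X k) j))\<^sup>2 \<le> C * real n"
    and eig: "\<And>\<mu>. eigenvalue (Sigma_mat n X {1..q}) \<mu> \<Longrightarrow> c \<le> \<mu>"
    and null: "\<And>k. k \<in> {q + 1..p} \<Longrightarrow> l2 (\<beta> k) = 0"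
    and signal: "\<And>k. k \<in> {1..q} \<Longrightarrow> 0 < l2 (\<beta> k)"
  obtains r w where
    "\<And>k j. k \<in> {q + 1..p} \<Longrightarrow> j < d k \<Longrightarrow> L2_set (r k j) {..<n} \<le> sqrt (C * real n)"
    "\<And>k. k \<in> {1..q} \<Longrightarrow> L2_set (w k) {..<n} \<le> 1 / sqrt (real n * c)"
    "\<And>k. k \<in> {1..q} \<Longrightarrow> 1 / sqrt (real n * C * real (d k)) \<le> L2_set (w k) {..<n}"
    "\<And>\<epsilon> lam bt bh m. is_adaptive_group_lasso n p d X (response n p X \<beta> \<epsilon>) lam bt bh \<Longrightarrow> 0 \<le> lam \<Longrightarrow>
      (\<And>k. k \<in> {1..q} \<Longrightarrow> l2 (bt k) \<noteq> 0 \<and> lam * sqrt (d k) / l2 (bt k) \<le> m) \<Longrightarrow>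
      (\<And>k. k \<in> {q + 1..p} \<Longrightarrow> l2 (bt k) \<noteq> 0 \<Longrightarrow>
        L2_set (\<lambda>j. ip n \<epsilon> (r k j)) {..<d k} + m * sqrt (real q * C / c) * sqrt (d k)
          < lam * sqrt (d k) / l2 (bt k)) \<Longrightarrow>
      (\<And>k. k \<in> {1..q} \<Longrightarrow> m * (sqrt (real q) / (real n * c)) < \<bar>ip n \<epsilon> (w k) + l2 (\<beta> k)\<bar>) \<Longrightarrow>
      (\<forall>k\<in>{1..q}. l2 (bh k) \<noteq> 0) \<and> (\<forall>k\<in>{q + 1..p}. l2 (bh k) = 0)"
proof -
  let ?S = "{1..q}" and ?A = "{q + 1..p}"
  define x where "x = (\<lambda>k j i. X k $$ (i, j))"
  define f where "f = fit ?S d x"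
  define b where "b = (\<lambda>k j. \<beta> k $ j)"
  have P: "{1..p} = ?S \<union> ?A" "?S \<inter> ?A = {}" using q by auto
  have XS: "X k \<in> carrier_mat n (d k)" if "k \<in> ?S" for k using dims[of k] that q by auto
  have XP: "X k \<in> carrier_mat n (d k)" if "k \<in> {1..p}" for k using dims[of k] that by auto
  have coer: "real n * c * (\<Sum>k\<in>?S. (gnorm d b k)\<^sup>2) \<le> ip n (f b) (f b)" for b
    unfolding f_def x_def by (rule gram_coercive[OF n q(1) _ eig]) (use dims q in auto)
  have col_ip: "ip n (x k j) (x k j) \<le> C * real n" if "k \<in> {1..p}" "j < d k" for k j
    unfolding x_def using col[OF that] l2_col[OF XP[OF that(1)] that(2)] by simp
  have col_L2: "L2_set (x k j) {..<n} \<le> sqrt (C * real n)" if "k \<in> {1..p}" "j < d k" for k j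
    using col_ip[OF that] by (intro real_le_rsqrt) (simp add: ip_self)
  have gn\<beta>: "gnorm d b k = l2 (\<beta> k)" if "k \<in> {1..p}" for k
    unfolding b_def using dims[OF that] l2_eq_L2_set[of "\<beta> k" "d k"] by simp
  define Pg where "Pg = (\<lambda>k j g. (\<forall>b. ip n (\<lambda>i. x k j i - f g i) (f b) = 0) \<and>
      L2_set (\<lambda>i. x k j i - f g i) {..<n} \<le> sqrt (C * real n) \<and>
      (\<Sum>l\<in>?S. gnorm d g l) \<le> sqrt (real q * C / c))"
  define g where "g = (\<lambda>k j. SOME g. Pg k j g)"
  have Pg: "Pg k j (g k j)" if "k \<in> ?A" "j < d k" for k j
    unfolding g_def
  proof -
    have "k \<in> {1..p}" using that by auto
    from regression_residual[where X = X and d = d and q = q and v = "x k j" and C = C, folded x_def f_def,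
        OF n c XS coer col_ip[OF this that(2)]]
    have "\<exists>g. Pg k j g" unfolding Pg_def by metis
    then show "Pg k j (SOME g. Pg k j g)" by (rule someI_ex)
  qed
  have g: "\<And>k j b. k \<in> ?A \<Longrightarrow> j < d k \<Longrightarrow> ip n (\<lambda>i. x k j i - f (g k j) i) (f b) = 0"
    "\<And>k j. k \<in> ?A \<Longrightarrow> j < d k \<Longrightarrow> L2_set (\<lambda>i. x k j i - f (g k j) i) {..<n} \<le> sqrt (C * real n)"
    "\<And>k j. k \<in> ?A \<Longrightarrow> j < d k \<Longrightarrow> (\<Sum>l\<in>?S. gnorm d (g k j) l) \<le> sqrt (real q * C / c)"
    using Pg unfolding Pg_def by blast+
  define u where "u = (\<lambda>k j. b k j / l2 (\<beta> k))"
  have u1: "L2_set (u k) {..<d k} = 1" and u\<beta>: "(\<Sum>j<d k. u k j * b k j) = l2 (\<beta> k)" if "k \<in> ?S" for k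
  proof -
    have k: "k \<in> {1..p}" "0 < l2 (\<beta> k)" using that signal q by auto
    have "u k = (\<lambda>j. (1 / l2 (\<beta> k)) * b k j)" by (simp add: u_def)
    then show "L2_set (u k) {..<d k} = 1"
      using gn\<beta>[OF k(1)] k(2) by (simp only: L2_set_scale) simp
    have "(\<Sum>j<d k. u k j * b k j) = (gnorm d b k)\<^sup>2 / l2 (\<beta> k)"
      by (simp add: u_def L2_set_def sum_nonneg power2_eq_square sum_divide_distrib)
    then show "(\<Sum>j<d k. u k j * b k j) = l2 (\<beta> k)"
      using gn\<beta>[OF k(1)] k(2) by (simp add: power2_eq_square)
  qed
  define Pv where "Pv = (\<lambda>k v. (\<forall>b. ip n (f v) (f b) = (\<Sum>j<d k. u k j * b k j)) \<and>
      L2_set (f v) {..<n} \<le> 1 / sqrt (real n * c) \<and>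
      1 / sqrt (real n * C * real (d k)) \<le> L2_set (f v) {..<n} \<and>
      (\<Sum>l\<in>?S. gnorm d v l) \<le> sqrt (real q) / (real n * c))"
  define v where "v = (\<lambda>k. SOME v. Pv k v)"
  have Pv: "Pv k (v k)" if k: "k \<in> ?S" for k
    unfolding v_def
  proof -
    have kp: "k \<in> {1..p}" using k q by auto
    have col_k: "L2_set (\<lambda>i. X k $$ (i, j)) {..<n} \<le> sqrt (C * real n)" if "j < d k" for j
      using col_L2[OF kp that] by (simp add: x_def)
    have "\<exists>v. Pv k v"
    proof (rule signal_direction[where X = X and d = d and q = q and u = "u k" and C = C and ?k0.0 = k,
          folded x_def f_def, OF n c XS coer col_k k u1[OF k] C])
      fix v
      assume "\<And>b. ip n (f v) (f b) = (\<Sum>j<d k. u k j * b k j)"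
        "L2_set (f v) {..<n} \<le> 1 / sqrt (real n * c)"
        "1 / sqrt (real n * C * real (d k)) \<le> L2_set (f v) {..<n}"
        "(\<Sum>l\<in>?S. gnorm d v l) \<le> sqrt (real q) / (real n * c)"
      then show "\<exists>v. Pv k v" unfolding Pv_def by blast
    qed
    then show "Pv k (SOME v. Pv k v)" by (rule someI_ex)
  qed
  have v: "\<And>k b. k \<in> ?S \<Longrightarrow> ip n (f (v k)) (f b) = (\<Sum>j<d k. u k j * b k j)"
    "\<And>k. k \<in> ?S \<Longrightarrow> L2_set (f (v k)) {..<n} \<le> 1 / sqrt (real n * c)"
    "\<And>k. k \<in> ?S \<Longrightarrow> 1 / sqrt (real n * C * real (d k)) \<le> L2_set (f (v k)) {..<n}"
    "\<And>k. k \<in> ?S \<Longrightarrow> (\<Sum>l\<in>?S. gnorm d (v k) l) \<le> sqrt (real q) / (real n * c)"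
    using Pv unfolding Pv_def by blast+
  show thesis
  proof (rule that[of "\<lambda>k j i. x k j i - f (g k j) i" "\<lambda>k. f (v k)"])
    fix \<epsilon> lam bt bh m
    assume lasso: "is_adaptive_group_lasso n p d X (response n p X \<beta> \<epsilon>) lam bt bh" and lam: "0 \<le> lam"
      and wS: "\<And>k. k \<in> ?S \<Longrightarrow> l2 (bt k) \<noteq> 0 \<and> lam * sqrt (d k) / l2 (bt k) \<le> m"
      and wA: "\<And>k. k \<in> ?A \<Longrightarrow> l2 (bt k) \<noteq> 0 \<Longrightarrow>
        L2_set (\<lambda>j. ip n \<epsilon> (\<lambda>i. x k j i - f (g k j) i)) {..<d k} + m * sqrt (real q * C / c) * sqrt (d k)
          < lam * sqrt (d k) / l2 (bt k)"
      and noise: "\<And>k. k \<in> ?S \<Longrightarrow> m * (sqrt (real q) / (real n * c)) < \<bar>ip n \<epsilon> (f (v k)) + l2 (\<beta> k)\<bar>"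
    define F where "F = {k \<in> {1..p}. l2 (bt k) \<noteq> 0}"
    define y where "y = response n p X \<beta> \<epsilon>"
    define h where "h = (\<lambda>k j. bh k $ j)"
    define \<mu> where "\<mu> = (\<lambda>k. lam * sqrt (d k) / l2 (bt k))"
    have yc: "y \<in> carrier_vec n"
      by (rule carrier_vecI) (simp add: y_def response_def)
    have b0: "b k j = 0" if "k \<in> ?A" "j < d k" for k j
      using gn\<beta>[of k] null[OF that(1)] that q by (auto simp: L2_set_eq_0_iff)
    have y: "y $ i = f b i + \<epsilon> i" if "i < n" for i
    proof -
      have "y $ i = lin_pred n p X \<beta> $ i + \<epsilon> i" using that by (simp add: y_def response_def lin_pred_dim)
      also have "lin_pred n p X \<beta> $ i = fit {1..p} d x b i"
        unfolding x_def b_def by (rule lin_pred_index[OF XP _ that]) (use dims in auto)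
      also have "\<dots> = f b i"
        unfolding P(1) f_def fit_union[OF finite_atLeastAtMost finite_atLeastAtMost P(2)]
        using fit_0[of ?A d b x i] b0 by simp
      finally show ?thesis .
    qed
    note VI = lasso_variational_inequality[where X = X and d = d and bh = bh,
        OF XP yc lam lasso[folded y_def] F_def]
    have SF: "?S \<subseteq> F" and FP: "F \<subseteq> ?S \<union> ?A" using wS q by (auto simp: F_def)
    have PF: "k \<in> {1..p} - F" if "k \<in> ?A - F" for k using that by auto
    have AF: "k \<in> ?A - F" if "k \<in> {1..p} - F" for k using that SF unfolding P(1) by auto
    have vi: "ip n (\<lambda>i. y $ i - fit (?S \<union> ?A) d x h i) (fit (?S \<union> ?A) d x \<gamma>)
        \<le> (\<Sum>k\<in>F. \<mu> k * (L2_set (\<lambda>j. h k j + \<gamma> k j) {..<d k} - gnorm d h k))"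
      if "\<And>k j. k \<in> ?A - F \<Longrightarrow> j < d k \<Longrightarrow> \<gamma> k j = 0" for \<gamma>
      unfolding P(1)[symmetric] \<mu>_def x_def h_def
    proof (rule VI(2))
      fix k j assume a: "k \<in> {1..p} - F" "j < d k"
      from that[OF AF[OF a(1)] a(2)] show "\<gamma> k j = 0" .
    qed
    have \<mu>S: "0 \<le> \<mu> k \<and> \<mu> k \<le> m" if "k \<in> ?S" for k
      using wS[OF that] lam by (auto simp: \<mu>_def l2_nonneg)
    have m: "0 \<le> m" using \<mu>S[of 1] q by auto
    have zero: "gnorm d h k = 0" if "k \<in> ?A" for k
    proof (rule null_groups_vanish[where S = ?S and A = ?A and F = F and \<beta> = b and \<epsilon> = \<epsilon> and x = x
          and g = g and m = m and G = "sqrt (real q * C / c)" and \<mu> = \<mu> and y = "vec_index y" and n = n and h = h and d = d and k = k])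
      show "h k j = 0" if "k \<in> ?A - F" "j < d k" for k j unfolding h_def by (rule VI(1)[OF _ PF[OF that(1)] that(2)])
      show "L2_set (\<lambda>j. ip n \<epsilon> (\<lambda>i. x k j i - fit ?S d x (g k j) i)) {..<d k}
          + m * sqrt (real q * C / c) * sqrt (d k) < \<mu> k" if "k \<in> ?A \<inter> F" for k
        using wA[of k] that by (auto simp: F_def f_def \<mu>_def)
      show "ip n (\<lambda>i. x k j i - fit ?S d x (g k j) i) (fit ?S d x b) = 0" if "k \<in> ?A" "j < d k" for k j b
        using g(1)[OF that] by (simp add: f_def)
    qed (use P SF FP y vi \<mu>S m g(3) that in \<open>auto simp: f_def\<close>)
    have bh: "bh k \<in> carrier_vec (d k)" if "k \<in> {1..p}" for k
      using lasso that by (auto simp: is_adaptive_group_lasso_def)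
    have l2h: "l2 (bh k) = gnorm d h k" if "k \<in> {1..p}" for k
      using l2_eq_L2_set[OF bh[OF that]] by (simp add: h_def)
    have "l2 (bh k) \<noteq> 0" if k: "k \<in> ?S" for k
    proof
      assume "l2 (bh k) = 0"
      then have hk: "gnorm d h k = 0" using l2h[of k] k q by auto
      have kp: "k \<in> {1..p}" using k q by auto
      have "\<bar>ip n \<epsilon> (fit ?S d x (v k)) + gnorm d b k\<bar> \<le> m * (sqrt (real q) / (real n * c))"
        by (rule vanishing_group_noise[where S = ?S and A = ?A and F = F and h = h and \<mu> = \<mu> and y = "vec_index y" and u = "u k"
              and d = d and x = x and \<beta> = b and n = n])
          (use P SF FP y vi \<mu>S zero k hk v(1,4) u\<beta>[OF k] gn\<beta>[OF kp] in \<open>auto simp: f_def\<close>)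
      with noise[OF k] gn\<beta>[OF kp] show False by (simp add: f_def)
    qed
    moreover have "l2 (bh k) = 0" if "k \<in> ?A" for k
      using zero[OF that] l2h[of k] that q by auto
    ultimately show "(\<forall>k\<in>?S. l2 (bh k) \<noteq> 0) \<and> (\<forall>k\<in>?A. l2 (bh k) = 0)" by blast
  qed (use g(2) v(2,3) in auto)
qed

lemma l2_measurable:
  assumes "random_groups M p d b" "k \<in> {1..p}"
  shows "(\<lambda>\<omega>. l2 (b \<omega> k)) \<in> borel_measurable M"
proof -
  have "(\<lambda>\<omega>. sqrt (\<Sum>j<d k. (b \<omega> k $ j)\<^sup>2)) \<in> borel_measurable M"
    by (intro measurable_compose[OF _ borel_measurable_sqrt] borel_measurable_sum borel_measurable_power)
      (use assms in \<open>auto simp: random_groups_def\<close>)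
  moreover have "l2 (b \<omega> k) = sqrt (\<Sum>j<d k. (b \<omega> k $ j)\<^sup>2)" if "\<omega> \<in> space M" for \<omega>
    using assms that l2_eq_L2_set[of "b \<omega> k" "d k"] unfolding random_groups_def L2_set_def by auto
  ultimately show ?thesis by (simp cong: measurable_cong)
qed

text \<open>Outside four kinds of events the hypotheses of the deterministic lemma hold: a null weight too small, a signal weight too
large, a large noise form for some null group (\<open>N3\<close>), a near coincidence for some signal group (\<open>N4\<close>).  The threshold
\<open>lam * r / K\<close> for the null weights is split evenly between noise and the cross term \<open>cross\<close>.  The
alternatives in the hypothesis on \<open>Q\<close> are the two ways to bound the total probability of the coincidences: Gaussian tails, which
need \<open>\<theta>\<close> above the noise level, and the bounded density, which is lossy in a union and therefore reserved to \<open>q = 1\<close>.\<close>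

lemma (in prob_space) selection_probability:
  fixes X :: "nat \<Rightarrow> real mat" and \<beta> :: "nat \<Rightarrow> real Matrix.vec" and c C lam r K\<^sub>0 K \<xi> \<sigma> Q :: real
    and n p q :: nat and d :: "nat \<Rightarrow> nat" and bt bh :: "'a \<Rightarrow> nat \<Rightarrow> real Matrix.vec"
  defines "\<theta> \<equiv> theta_min q \<beta>" and "da \<equiv> real (d_max p d)"
  defines "m \<equiv> lam * sqrt da / (\<xi> * \<theta>)"
  defines "\<eta> \<equiv> m * (sqrt (real q) / (real n * c))"
  assumes n: "1 \<le> n" and q: "1 \<le> q" "q < p" and c: "0 < c" and C: "0 < C"
    and dims: "\<And>k. k \<in> {1..p} \<Longrightarrow> 1 \<le> d k \<and> X k \<in> carrier_mat n (d k) \<and> \<beta> k \<in> carrier_vec (d k)"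
    and col: "\<And>k j. k \<in> {1..p} \<Longrightarrow> j < d k \<Longrightarrow> (l2 (col (X k) j))\<^sup>2 \<le> C * real n"
    and eig: "\<And>\<mu>. eigenvalue (Sigma_mat n X {1..q}) \<mu> \<Longrightarrow> c \<le> \<mu>"
    and null: "\<And>k. k \<in> {q + 1..p} \<Longrightarrow> l2 (\<beta> k) = 0"
    and \<theta>: "0 < \<theta>" and lam: "0 < lam" and r: "0 < r" and K: "0 < K" "K\<^sub>0 \<le> K" and \<xi>: "0 < \<xi>" and \<sigma>: "0 < \<sigma>"
    and bt: "random_groups M p d bt" and bh: "random_groups M p d bh"
    and lasso: "\<And>\<omega>. \<omega> \<in> space M \<Longrightarrow> is_adaptive_group_lasso n p d X
        (response n p X \<beta> (\<lambda>i. err i \<omega>)) lam (bt \<omega>) (bh \<omega>)"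
    and indep: "indep_vars (\<lambda>_. borel) err {..<n}"
    and normal: "\<And>i. i < n \<Longrightarrow> distributed M lborel (err i) (normal_density 0 \<sigma>)"
    and cross: "m * sqrt (real q * C / c) \<le> lam * r / (2 * K)"
    and \<eta>: "\<eta> \<le> \<theta> / 2"
    and Q: "real q * (sqrt 2 * exp (- (\<theta>\<^sup>2 * real n * c / (16 * \<sigma>\<^sup>2)))) \<le> Q
        \<or> q = 1 \<and> \<eta> * sqrt (real n * C * da) / \<sigma> \<le> Q"
  shows "prob {\<omega>\<in>space M. (\<forall>k\<in>{1..q}. l2 (bh \<omega> k) \<noteq> 0) \<and> (\<forall>k\<in>{q + 1..p}. l2 (bh \<omega> k) = 0)}
    \<ge> 1 - (prob {\<omega>\<in>space M. \<bar>r * Max ((\<lambda>k. l2 (bt \<omega> k)) ` {q + 1..p})\<bar> > K\<^sub>0}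
      + (1 - prob {\<omega>\<in>space M. Min ((\<lambda>k. l2 (bt \<omega> k)) ` {1..q}) > \<xi> * \<theta>})
      + real (p - q) * (sqrt 2 * exp (- ((lam * r / (2 * K))\<^sup>2 / (4 * (\<sigma> * sqrt (C * real n))\<^sup>2))))
      + Q)"
    (is "prob ?good \<ge> 1 - (prob ?N1 + (1 - prob ?N2) + ?T + Q)")
proof -
  let ?S = "{1..q}" and ?A = "{q + 1..p}"
  define t where "t = lam * r / (2 * K)"
  have t: "0 < t" using lam r K by (simp add: t_def)
  have \<theta>_le: "\<theta> \<le> l2 (\<beta> k)" if "k \<in> ?S" for k
    unfolding \<theta>_def theta_min_def using that by (intro Min_le) auto
  have d_le: "real (d k) \<le> da" if "k \<in> {1..p}" for k
    unfolding da_def d_max_def using that by (intro of_nat_mono Max_ge) auto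
  have signal: "0 < l2 (\<beta> k)" if "k \<in> ?S" for k using \<theta>_le[OF that] \<theta> by simp
  have "q \<le> p" using q by simp
  show ?thesis
  proof (rule adaptive_lasso_selects[where X = X and d = d and \<beta> = \<beta>, OF n q(1) \<open>q \<le> p\<close> c C dims col eig null signal])
    fix R w
    assume
      R: "\<And>k j. k \<in> ?A \<Longrightarrow> j < d k \<Longrightarrow> L2_set (R k j) {..<n} \<le> sqrt (C * real n)"
      and w: "\<And>k. k \<in> ?S \<Longrightarrow> L2_set (w k) {..<n} \<le> 1 / sqrt (real n * c)"
        "\<And>k. k \<in> ?S \<Longrightarrow> 1 / sqrt (real n * C * real (d k)) \<le> L2_set (w k) {..<n}"
      and select: "\<And>\<epsilon> lam bt bh m. is_adaptive_group_lasso n p d X (response n p X \<beta> \<epsilon>) lam bt bh \<Longrightarrow> 0 \<le> lam \<Longrightarrow>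
        (\<And>k. k \<in> ?S \<Longrightarrow> l2 (bt k) \<noteq> 0 \<and> lam * sqrt (d k) / l2 (bt k) \<le> m) \<Longrightarrow>
        (\<And>k. k \<in> ?A \<Longrightarrow> l2 (bt k) \<noteq> 0 \<Longrightarrow>
          L2_set (\<lambda>j. ip n \<epsilon> (R k j)) {..<d k} + m * sqrt (real q * C / c) * sqrt (d k)
            < lam * sqrt (d k) / l2 (bt k)) \<Longrightarrow>
        (\<And>k. k \<in> ?S \<Longrightarrow> m * (sqrt (real q) / (real n * c)) < \<bar>ip n \<epsilon> (w k) + l2 (\<beta> k)\<bar>) \<Longrightarrow>
        (\<forall>k\<in>?S. l2 (bh k) \<noteq> 0) \<and> (\<forall>k\<in>?A. l2 (bh k) = 0)"
    define N3 where "N3 = (\<lambda>k. {\<omega>\<in>space M. t * sqrt (real (d k)) \<le> L2_set (\<lambda>j. ip n (\<lambda>i. err i \<omega>) (R k j)) {..<d k}})"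
    define N4 where "N4 = (\<lambda>k. {\<omega>\<in>space M. \<bar>ip n (\<lambda>i. err i \<omega>) (w k) + l2 (\<beta> k)\<bar> \<le> \<eta>})"
    have form[measurable]: "(\<lambda>\<omega>. ip n (\<lambda>i. err i \<omega>) a) \<in> borel_measurable M" for a
      by (rule linear_form_measurable[OF normal])
    have bt_meas: "(\<lambda>\<omega>. l2 (bt \<omega> k)) \<in> borel_measurable M" if "k \<in> {1..p}" for k
      by (rule l2_measurable[OF bt that])
    have bh_meas: "(\<lambda>\<omega>. l2 (bh \<omega> k)) \<in> borel_measurable M" if "k \<in> {1..p}" for k
      by (rule l2_measurable[OF bh that])
    have good_meas: "?good \<in> events"
    proof -
      have "{\<omega>\<in>space M. l2 (bh \<omega> k) \<noteq> 0} \<in> events" "{\<omega>\<in>space M. l2 (bh \<omega> k) = 0} \<in> events"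
        if "k \<in> {1..p}" for k
      proof -
        have [measurable]: "(\<lambda>\<omega>. l2 (bh \<omega> k)) \<in> borel_measurable M" by (rule bh_meas[OF that])
        show "{\<omega>\<in>space M. l2 (bh \<omega> k) \<noteq> 0} \<in> events" "{\<omega>\<in>space M. l2 (bh \<omega> k) = 0} \<in> events"
          by measurable
      qed
      then show ?thesis
        using q by (intro sets.sets_Collect_conj sets.sets_Collect_finite_All) auto
    qed
    have N1_meas: "?N1 \<in> events"
    proof -
      have [measurable]: "(\<lambda>\<omega>. Max ((\<lambda>k. l2 (bt \<omega> k)) ` ?A)) \<in> borel_measurable M"
        by (rule borel_measurable_Max) (use bt_meas in auto)
      show ?thesis by measurable
    qed
    have N2_meas: "?N2 \<in> events"
    proof -
      have [measurable]: "(\<lambda>\<omega>. Min ((\<lambda>k. l2 (bt \<omega> k)) ` ?S)) \<in> borel_measurable M"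
        by (rule borel_measurable_Min) (use bt_meas q in auto)
      show ?thesis by measurable
    qed
    have N3_meas: "N3 k \<in> events" for k
      unfolding N3_def L2_set_def by measurable
    have N4_meas: "N4 k \<in> events" for k
      unfolding N4_def by measurable
    have cover: "space M \<subseteq> ?good \<union> (?N1 \<union> ((space M - ?N2) \<union> ((\<Union>k\<in>?A. N3 k) \<union> (\<Union>k\<in>?S. N4 k))))"
    proof
      fix \<omega> assume \<omega>: "\<omega> \<in> space M"
      show "\<omega> \<in> ?good \<union> (?N1 \<union> ((space M - ?N2) \<union> ((\<Union>k\<in>?A. N3 k) \<union> (\<Union>k\<in>?S. N4 k))))"
      proof (rule ccontr)
        assume out: "\<not> ?thesis"
        have 1: "\<bar>r * Max ((\<lambda>k. l2 (bt \<omega> k)) ` ?A)\<bar> \<le> K\<^sub>0" using out \<omega> by auto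
        have 2: "\<xi> * \<theta> < Min ((\<lambda>k. l2 (bt \<omega> k)) ` ?S)" using out \<omega> by auto
        have 3: "L2_set (\<lambda>j. ip n (\<lambda>i. err i \<omega>) (R k j)) {..<d k} < t * sqrt (real (d k))" if "k \<in> ?A" for k
          using out \<omega> that unfolding N3_def by (auto simp: not_le)
        have 4: "\<eta> < \<bar>ip n (\<lambda>i. err i \<omega>) (w k) + l2 (\<beta> k)\<bar>" if "k \<in> ?S" for k
          using out \<omega> that unfolding N4_def by (auto simp: not_le)
        have "(\<forall>k\<in>?S. l2 (bh \<omega> k) \<noteq> 0) \<and> (\<forall>k\<in>?A. l2 (bh \<omega> k) = 0)"
        proof (rule select[of "\<lambda>i. err i \<omega>" lam "bt \<omega>" "bh \<omega>" m, OF lasso[OF \<omega>]])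
          show "0 \<le> lam" using lam by simp
          show "l2 (bt \<omega> k) \<noteq> 0 \<and> lam * sqrt (d k) / l2 (bt \<omega> k) \<le> m" if k: "k \<in> ?S" for k
          proof -
            have "Min ((\<lambda>k. l2 (bt \<omega> k)) ` ?S) \<le> l2 (bt \<omega> k)" using k by (intro Min_le) auto
            with 2 have bt: "\<xi> * \<theta> < l2 (bt \<omega> k)" by simp
            moreover have \<xi>\<theta>: "0 < \<xi> * \<theta>" using \<xi> \<theta> by simp
            moreover have "lam * sqrt (d k) / l2 (bt \<omega> k) \<le> lam * sqrt da / (\<xi> * \<theta>)"
              using lam d_le[of k] k q bt \<xi>\<theta> by (intro frac_le mult_left_mono real_sqrt_le_mono) auto
            ultimately show ?thesis by (auto simp: m_def)
          qed
          show "L2_set (\<lambda>j. ip n (\<lambda>i. err i \<omega>) (R k j)) {..<d k} + m * sqrt (real q * C / c) * sqrt (d k)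
              < lam * sqrt (d k) / l2 (bt \<omega> k)" if k: "k \<in> ?A" and nz: "l2 (bt \<omega> k) \<noteq> 0" for k
          proof -
            have pos: "0 < l2 (bt \<omega> k)" using nz l2_nonneg[of "bt \<omega> k"] by simp
            have "l2 (bt \<omega> k) \<le> Max ((\<lambda>k. l2 (bt \<omega> k)) ` ?A)" using k by (intro Max_ge) auto
            then have "r * l2 (bt \<omega> k) \<le> r * Max ((\<lambda>k. l2 (bt \<omega> k)) ` ?A)"
              using r by (intro mult_left_mono) auto
            then have le: "r * l2 (bt \<omega> k) \<le> K" using 1 K(2) by linarith
            have "m * sqrt (real q * C / c) * sqrt (d k) \<le> t * sqrt (d k)"
              using cross by (intro mult_right_mono) (auto simp: t_def)
            then have "L2_set (\<lambda>j. ip n (\<lambda>i. err i \<omega>) (R k j)) {..<d k} + m * sqrt (real q * C / c) * sqrt (d k)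
                < 2 * t * sqrt (d k)"
              using 3[OF k] by linarith
            also have "2 * t * sqrt (d k) = lam * sqrt (d k) * (r / K)" using K by (simp add: t_def)
            also have "\<dots> \<le> lam * sqrt (d k) * (1 / l2 (bt \<omega> k))"
              using le pos K lam by (intro mult_left_mono) (auto simp: field_simps)
            finally show ?thesis by simp
          qed
          show "m * (sqrt (real q) / (real n * c)) < \<bar>ip n (\<lambda>i. err i \<omega>) (w k) + l2 (\<beta> k)\<bar>" if "k \<in> ?S" for k
            using 4[OF that] by (simp add: \<eta>_def)
        qed
        then show False using out \<omega> by simp
      qed
    qed
    have N3_prob: "prob (N3 k) \<le> sqrt 2 * exp (- (t\<^sup>2 / (4 * (\<sigma> * sqrt (C * real n))\<^sup>2)))" if k: "k \<in> ?A" for k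
      unfolding N3_def
    proof (rule Gaussian_group_tail[OF \<sigma> indep normal])
      show "\<sigma> * L2_set (R k j) {..<n} \<le> \<sigma> * sqrt (C * real n)" if "j < d k" for j
        using R[OF k that] \<sigma> by (intro mult_left_mono) auto
      show "1 \<le> d k" using dims[of k] k by simp
      show "0 < \<sigma> * sqrt (C * real n)" using \<sigma> C n by simp
    qed (use t in auto)
    have tail: "prob (N4 k) \<le> sqrt 2 * exp (- (\<theta>\<^sup>2 * real n * c / (16 * \<sigma>\<^sup>2)))" if k: "k \<in> ?S" for k
    proof -
      let ?s = "\<sigma> / sqrt (real n * c)"
      have s: "0 < ?s" using \<sigma> n c by simp
      \<comment> \<open>Since \<open>\<eta> \<le> \<theta> / 2\<close>, a coincidence forces the form to be at least \<open>\<theta> / 2\<close> in absolute value.\<close>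
    have "N4 k \<subseteq> {\<omega>\<in>space M. \<theta> / 2 * sqrt (real 1) \<le> L2_set (\<lambda>j. ip n (\<lambda>i. err i \<omega>) (w k)) {..<1::nat}}"
        using \<theta>_le[OF k] \<eta> unfolding N4_def by (auto simp: lessThan_Suc)
      then have "prob (N4 k) \<le> prob {\<omega>\<in>space M. \<theta> / 2 * sqrt (real 1) \<le> L2_set (\<lambda>j. ip n (\<lambda>i. err i \<omega>) (w k)) {..<1::nat}}"
        by (rule finite_measure_mono) (unfold L2_set_def, measurable)
      also have "\<dots> \<le> sqrt 2 * exp (- ((\<theta> / 2)\<^sup>2 / (4 * ?s\<^sup>2)))"
      proof (rule Gaussian_group_tail[OF \<sigma> indep normal])
        show "\<sigma> * L2_set (w k) {..<n} \<le> ?s"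
          using mult_left_mono[OF w(1)[OF k], of \<sigma>] \<sigma> by simp
      qed (use s \<theta> in auto)
      also have "(\<theta> / 2)\<^sup>2 / (4 * ?s\<^sup>2) = \<theta>\<^sup>2 * real n * c / (16 * \<sigma>\<^sup>2)"
        using n c by (simp add: power_divide)
      finally show ?thesis .
    qed
    have \<eta>0: "0 \<le> \<eta>" using lam \<xi> \<theta> n c by (simp add: \<eta>_def m_def da_def)
    have small_ball: "prob (N4 k) \<le> \<eta> * sqrt (real n * C * da) / \<sigma>" if k: "k \<in> ?S" for k
    proof -
      have dk: "1 \<le> d k" "real (d k) \<le> da" using dims[of k] d_le[of k] k q by auto
      have low: "1 / sqrt (real n * C * da) \<le> 1 / sqrt (real n * C * real (d k))"
        using dk n C by (intro divide_left_mono real_sqrt_le_mono mult_left_mono mult_pos_pos) auto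
      have da: "0 < sqrt (real n * C * da)" using dk n C by simp
      have L: "1 / sqrt (real n * C * da) \<le> L2_set (w k) {..<n}" using low w(2)[OF k] by simp
      have L0: "0 < L2_set (w k) {..<n}" by (rule less_le_trans[OF _ L]) (use da in simp)
      have "prob (N4 k) \<le> \<eta> / (\<sigma> * L2_set (w k) {..<n})"
        unfolding N4_def
        by (rule Gaussian_anticoncentration[OF Gaussian_linear_form[OF \<sigma> indep normal L0] _ \<eta>0])
          (use \<sigma> L0 in auto)
      also have "\<dots> \<le> \<eta> / (\<sigma> * (1 / sqrt (real n * C * da)))"
        using L L0 \<sigma> da \<eta>0 by (intro divide_left_mono mult_left_mono mult_pos_pos) auto
      finally show ?thesis by simp
    qed
    have N4_sum: "(\<Sum>k\<in>?S. prob (N4 k)) \<le> Q"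
      using Q
    proof
      assume *: "real q * (sqrt 2 * exp (- (\<theta>\<^sup>2 * real n * c / (16 * \<sigma>\<^sup>2)))) \<le> Q"
      have "(\<Sum>k\<in>?S. prob (N4 k)) \<le> (\<Sum>k\<in>?S. sqrt 2 * exp (- (\<theta>\<^sup>2 * real n * c / (16 * \<sigma>\<^sup>2))))"
        by (rule sum_mono[OF tail])
      with * show ?thesis by simp
    next
      assume *: "q = 1 \<and> \<eta> * sqrt (real n * C * da) / \<sigma> \<le> Q"
      with small_ball[of 1] show ?thesis by simp
    qed
    have "(\<Sum>k\<in>?A. prob (N3 k)) \<le> (\<Sum>k\<in>?A. sqrt 2 * exp (- (t\<^sup>2 / (4 * (\<sigma> * sqrt (C * real n))\<^sup>2))))"
      by (rule sum_mono[OF N3_prob])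
    also have "\<dots> = ?T" by (simp add: t_def)
    finally have N3_sum: "(\<Sum>k\<in>?A. prob (N3 k)) \<le> ?T" .
    have U: "(\<Union>k\<in>?A. N3 k) \<in> events" "(\<Union>k\<in>?S. N4 k) \<in> events" "space M - ?N2 \<in> events"
      using N3_meas N4_meas N2_meas by auto
    have "1 = prob (space M)" by (simp add: prob_space)
    also have "\<dots> \<le> prob (?good \<union> (?N1 \<union> ((space M - ?N2) \<union> ((\<Union>k\<in>?A. N3 k) \<union> (\<Union>k\<in>?S. N4 k)))))"
      by (rule finite_measure_mono[OF cover]) (intro sets.Un good_meas N1_meas U)
    also have "\<dots> \<le> prob ?good + (prob ?N1 + (prob (space M - ?N2) + (prob (\<Union>k\<in>?A. N3 k) + prob (\<Union>k\<in>?S. N4 k))))"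
      by (intro order_trans[OF measure_Un_le] add_left_mono sets.Un good_meas N1_meas U order_refl)
    also have "prob (space M - ?N2) = 1 - prob ?N2" by (rule prob_compl[OF N2_meas])
    also have "prob (\<Union>k\<in>?A. N3 k) \<le> (\<Sum>k\<in>?A. prob (N3 k))"
      by (rule measure_UNION_le) (use N3_meas in auto)
    also have "prob (\<Union>k\<in>?S. N4 k) \<le> (\<Sum>k\<in>?S. prob (N4 k))"
      by (rule measure_UNION_le) (use N4_meas in auto)
    finally show ?thesis using N3_sum N4_sum by linarith
  qed
qed

section \<open>Asymptotics\<close>

text \<open>The hypothesis \<open>N \<ge> 2\<close> bounds \<open>ln N\<close> away from zero, so a large factor \<open>L\<close> makes the union bound small even for bounded \<open>N\<close>.\<close>

lemma union_exp_bound: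
  fixes N L x :: real
  assumes "2 \<le> N" "1 \<le> L" "L * ln N \<le> x"
  shows "N * exp (- x) \<le> exp (- ((L - 1) * ln 2))"
proof -
  have "N * exp (- x) \<le> N * exp (- (L * ln N))" using assms by simp
  also have "\<dots> = exp (ln N) * exp (- (L * ln N))" using assms by simp
  also have "\<dots> = exp (- ((L - 1) * ln N))" unfolding exp_add[symmetric] by (simp add: algebra_simps)
  also have "\<dots> \<le> exp (- ((L - 1) * ln 2))" using assms by (simp add: mult_left_mono)
  finally show ?thesis .
qed

lemma union_exp_rate:
  fixes e :: real
  assumes "0 < e"
  obtains L where "1 \<le> L" "sqrt 2 * exp (- ((L - 1) * ln 2)) \<le> e"
proof -
  define L where "L = 1 + max 0 (ln (sqrt 2 / e) / ln 2)"
  have "ln (sqrt 2 / e) / ln 2 \<le> L - 1" by (simp add: L_def)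
  define y where "y = (L - 1) * ln 2"
  have "ln (sqrt 2 / e) \<le> y"
    using \<open>ln (sqrt 2 / e) / ln 2 \<le> L - 1\<close> by (simp add: y_def pos_divide_le_eq)
  then have "exp (ln (sqrt 2 / e)) \<le> exp y" by simp
  then have "sqrt 2 \<le> e * exp y" using assms by (simp add: pos_divide_le_eq mult.commute)
  then have "sqrt 2 * exp (- y) \<le> e" by (simp add: exp_minus field_simps)
  then have "sqrt 2 * exp (- ((L - 1) * ln 2)) \<le> e" by (simp only: y_def)
  moreover have "1 \<le> L" by (simp add: L_def)
  ultimately show thesis using that by blast
qed

lemma powr_three_halves: "1 \<le> a \<Longrightarrow> (a :: real) powr (3/2) = a * sqrt a"
  using powr_add[of a 1 "1/2"] by (simp add: powr_half_sqrt)

lemma powr_five_halves: "1 \<le> a \<Longrightarrow> (a :: real) powr (5/2) = a\<^sup>2 * sqrt a"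
  using powr_add[of a 2 "1/2"] by (simp add: powr_half_sqrt)

text \<open>Here \<open>a\<close> and \<open>b\<close> stand for the largest and the smallest group size.  The powers that the argument produces, on the left, are
dominated by those in the rate conditions, on the right.\<close>

lemma dimension_bounds:
  fixes a b q :: real
  assumes "1 \<le> q" "1 \<le> b" "b \<le> a"
  shows "sqrt a * sqrt q \<le> a powr (5/2) * q\<^sup>2 / sqrt b"
    and "sqrt a * sqrt q \<le> a powr (3/2) * q"
    and "a * sqrt q \<le> a powr (3/2) * q"
proof -
  have a: "1 \<le> a" using assms by simp
  have sq: "sqrt q \<le> q" "sqrt a \<le> a" "1 \<le> sqrt a"
    using assms a self_le_power[of q 2] self_le_power[of a 2] by (auto intro!: real_le_lsqrt)
  have "sqrt a * sqrt b \<le> sqrt a * sqrt a" using assms by (intro mult_left_mono) auto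
  also have "\<dots> \<le> a\<^sup>2 * sqrt a"
    using sq self_le_power[OF a, of 2] by (intro mult_right_mono) auto
  finally have "sqrt a \<le> a\<^sup>2 * sqrt a / sqrt b" using assms by (simp add: pos_le_divide_eq)
  moreover have "sqrt q \<le> q\<^sup>2" using sq(1) assms self_le_power[of q 2] by simp
  ultimately have "sqrt a * sqrt q \<le> (a\<^sup>2 * sqrt a / sqrt b) * q\<^sup>2"
    using a assms by (intro mult_mono) auto
  then show "sqrt a * sqrt q \<le> a powr (5/2) * q\<^sup>2 / sqrt b" using powr_five_halves[OF a] by simp
  have "sqrt a * sqrt q \<le> (a * sqrt a) * q"
    using sq a assms by (intro mult_mono) (auto simp: mult_le_cancel_right1)
  then show "sqrt a * sqrt q \<le> a powr (3/2) * q" using powr_three_halves[OF a] by simp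
  have "a * sqrt q \<le> (a * sqrt a) * q"
    using sq a assms by (intro mult_mono) (auto simp: mult_le_cancel_left1)
  then show "a * sqrt q \<le> a powr (3/2) * q" using powr_three_halves[OF a] by simp
qed

lemma cross_term_small:
  fixes lam a b q r \<theta> K C c \<xi> :: real
  assumes pos: "0 < lam" "0 < r" "0 < \<theta>" "0 < K" "0 < C" "0 < c" "0 < \<xi>"
    and dim: "1 \<le> q" "1 \<le> b" "b \<le> a"
    and small: "a powr (5/2) * q\<^sup>2 / (r * \<theta> * sqrt b) \<le> \<xi> / (2 * K * sqrt (C / c))"
  shows "lam * sqrt a / (\<xi> * \<theta>) * sqrt (q * C / c) \<le> lam * r / (2 * K)"
proof -
  have "sqrt a * sqrt q / (r * \<theta>) \<le> (a powr (5/2) * q\<^sup>2 / sqrt b) / (r * \<theta>)"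
    using dimension_bounds(1)[OF dim] pos by (intro divide_right_mono) auto
  also have "\<dots> \<le> \<xi> / (2 * K * sqrt (C / c))" using small by (simp add: mult_ac)
  finally have "sqrt a * sqrt q \<le> \<xi> / (2 * K * sqrt (C / c)) * (r * \<theta>)"
    using pos by (subst (asm) pos_divide_le_eq) auto
  then have "(sqrt a * sqrt q) * (lam * sqrt (C / c) / (\<xi> * \<theta>))
      \<le> \<xi> / (2 * K * sqrt (C / c)) * (r * \<theta>) * (lam * sqrt (C / c) / (\<xi> * \<theta>))"
    using pos by (intro mult_right_mono) auto
  also have "\<dots> = lam * r / (2 * K)" using pos by (simp add: field_simps)
  also have "(sqrt a * sqrt q) * (lam * sqrt (C / c) / (\<xi> * \<theta>)) = lam * sqrt a / (\<xi> * \<theta>) * sqrt (q * C / c)"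
    using real_sqrt_mult[of q "C / c"] by (simp add: mult_ac)
  finally show ?thesis .
qed

text \<open>The second bound, with one more factor \<open>sqrt a\<close>, compares the bias with the lower bound
\<open>\<sigma> / sqrt (n * C * a)\<close> on the standard deviation of the noise along a test direction; it serves the case of a single signal group.\<close>

lemma penalty_bias_small:
  fixes lam a b q n \<theta> c \<xi> \<delta> :: real
  assumes pos: "0 < lam" "0 < n" "0 < \<theta>" "0 < c" "0 < \<xi>"
    and dim: "1 \<le> q" "1 \<le> a"
    and small: "lam * a powr (3/2) * q / (n * \<theta>\<^sup>2) \<le> \<delta>"
  shows "lam * sqrt a / (\<xi> * \<theta>) * (sqrt q / (n * c)) \<le> \<delta> / (\<xi> * c) * \<theta>"
    and "lam * sqrt a / (\<xi> * \<theta>) * (sqrt q / (n * c)) * sqrt a \<le> \<delta> / (\<xi> * c) * \<theta>"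
proof -
  have *: "lam * y / (n * \<theta> * (\<xi> * c)) \<le> \<delta> / (\<xi> * c) * \<theta>" if "y \<le> a powr (3/2) * q" for y
  proof -
    have "lam * y / (n * \<theta>\<^sup>2) \<le> lam * (a powr (3/2) * q) / (n * \<theta>\<^sup>2)"
      using that pos by (intro divide_right_mono mult_left_mono) auto
    also have "\<dots> \<le> \<delta>" using small by (simp add: mult_ac)
    finally have "lam * y / (n * \<theta>\<^sup>2) * (\<theta> / (\<xi> * c)) \<le> \<delta> * (\<theta> / (\<xi> * c))"
      using pos by (intro mult_right_mono) auto
    moreover have "lam * y / (n * \<theta>\<^sup>2) * (\<theta> / (\<xi> * c)) = lam * y / (n * \<theta> * (\<xi> * c))"
      using pos by (simp add: power2_eq_square)
    ultimately show ?thesis by simp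
  qed
  show "lam * sqrt a / (\<xi> * \<theta>) * (sqrt q / (n * c)) \<le> \<delta> / (\<xi> * c) * \<theta>"
    using *[OF dimension_bounds(2)[OF dim(1) order_refl[of 1] dim(2)]] by (simp add: mult_ac)
  have "lam * sqrt a / (\<xi> * \<theta>) * (sqrt q / (n * c)) * sqrt a = lam * (a * sqrt q) / (n * \<theta> * (\<xi> * c))"
    using dim real_sqrt_mult_self[of a] by (simp add: field_simps)
  then show "lam * sqrt a / (\<xi> * \<theta>) * (sqrt q / (n * c)) * sqrt a \<le> \<delta> / (\<xi> * c) * \<theta>"
    using *[OF dimension_bounds(3)[OF dim(1) order_refl[of 1] dim(2)]] by simp
qed

lemma null_tail_small:
  fixes lam dr N n r \<delta> K s C L e \<sigma> :: real
  assumes pos: "0 < lam" "0 < r" "0 < n" "0 < K" "0 < C" "0 < \<sigma>" and N: "2 \<le> N" and dr: "1 \<le> dr" and L: "1 \<le> L"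
    and small: "sqrt (n * dr * ln N) / (lam * r) \<le> 1 / (4 * K * \<sigma> * sqrt C * sqrt L)"
    and e: "sqrt 2 * exp (- ((L - 1) * ln 2)) \<le> e"
  shows "N * (sqrt 2 * exp (- ((lam * r / (2 * K))\<^sup>2 / (4 * (\<sigma> * sqrt (C * n))\<^sup>2)))) \<le> e"
proof -
  have lnN: "0 < ln N" using N by simp
  let ?D = "4 * K * \<sigma> * sqrt C * sqrt L"
  have D: "0 < ?D" using pos L by simp
  have "sqrt (n * ln N) \<le> sqrt (n * dr * ln N)"
    using pos dr lnN by (simp add: mult_le_cancel_right1)
  also have "\<dots> \<le> lam * r / ?D" using small pos D by (simp add: field_simps)
  finally have "(sqrt (n * ln N))\<^sup>2 \<le> (lam * r / ?D)\<^sup>2" using pos lnN by (intro power_mono) auto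
  then have "n * ln N \<le> (lam * r)\<^sup>2 / (16 * K\<^sup>2 * \<sigma>\<^sup>2 * C * L)"
    using pos lnN L by (simp add: power_divide power_mult_distrib)
  then have "L * ln N \<le> (lam * r)\<^sup>2 / (16 * K\<^sup>2 * \<sigma>\<^sup>2 * C * n)"
    using pos L by (simp add: field_simps)
  also have "\<dots> = (lam * r / (2 * K))\<^sup>2 / (4 * (\<sigma> * sqrt (C * n))\<^sup>2)"
    using pos by (simp add: power_divide power_mult_distrib)
  finally have "N * exp (- ((lam * r / (2 * K))\<^sup>2 / (4 * (\<sigma> * sqrt (C * n))\<^sup>2))) \<le> exp (- ((L - 1) * ln 2))"
    by (rule union_exp_bound[OF N L])
  then have "sqrt 2 * (N * exp (- ((lam * r / (2 * K))\<^sup>2 / (4 * (\<sigma> * sqrt (C * n))\<^sup>2)))) \<le> sqrt 2 * exp (- ((L - 1) * ln 2))"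
    by (intro mult_left_mono) auto
  with e show ?thesis by (subst mult.left_commute) linarith
qed

lemma signal_tail_small:
  fixes a q n \<theta> \<kappa> L e :: real
  assumes pos: "0 < n" "0 < \<theta>" "0 < \<kappa>" and q: "2 \<le> q" and a: "1 \<le> a" and L: "1 \<le> L"
    and small: "sqrt (a * ln q) / (sqrt n * \<theta>) \<le> sqrt (\<kappa> / L)"
    and e: "sqrt 2 * exp (- ((L - 1) * ln 2)) \<le> e"
  shows "q * (sqrt 2 * exp (- (\<kappa> * (\<theta>\<^sup>2 * n)))) \<le> e"
proof -
  have lnq: "0 < ln q" using q by simp
  have "sqrt (ln q) \<le> sqrt (a * ln q)" using a lnq by (simp add: mult_le_cancel_right1)
  also have "\<dots> \<le> sqrt (\<kappa> / L) * (sqrt n * \<theta>)" using small pos by (simp add: pos_divide_le_eq)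
  finally have "(sqrt (ln q))\<^sup>2 \<le> (sqrt (\<kappa> / L) * (sqrt n * \<theta>))\<^sup>2" using lnq by (intro power_mono) auto
  then have "ln q \<le> \<kappa> / L * (n * \<theta>\<^sup>2)" using lnq pos L by (simp add: power_mult_distrib)
  then have "L * ln q \<le> \<kappa> * (\<theta>\<^sup>2 * n)" using L by (simp add: field_simps)
  then have "q * exp (- (\<kappa> * (\<theta>\<^sup>2 * n))) \<le> exp (- ((L - 1) * ln 2))"
    by (rule union_exp_bound[OF q L])
  then have "sqrt 2 * (q * exp (- (\<kappa> * (\<theta>\<^sup>2 * n)))) \<le> sqrt 2 * exp (- ((L - 1) * ln 2))"
    by (intro mult_left_mono) auto
  with e show ?thesis by (subst mult.left_commute) linarith
qed

theorem theorem3p1: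
  fixes M :: "nat \<Rightarrow> 'a measure"
    and p q :: "nat \<Rightarrow> nat"
    and d :: "nat \<Rightarrow> nat \<Rightarrow> nat"
    and X :: "nat \<Rightarrow> nat \<Rightarrow> real mat"
    and \<beta> :: "nat \<Rightarrow> nat \<Rightarrow> real Matrix.vec"
    and err :: "nat \<Rightarrow> nat \<Rightarrow> 'a \<Rightarrow> real"
    and bt bh :: "nat \<Rightarrow> 'a \<Rightarrow> nat \<Rightarrow> real Matrix.vec"
    and lam r :: "nat \<Rightarrow> real"
    and \<sigma> :: real
  defines "\<theta> \<equiv> \<lambda>n. theta_min (q n) (\<beta> n)"
    and "da \<equiv> \<lambda>n. real (d_max (p n) (d n))"
    and "db \<equiv> \<lambda>n. real (d_min (p n) (d n))"
    and "dr \<equiv> \<lambda>n. d_ratio (p n) (d n)"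
  assumes prob: "\<And>n. n \<ge> 1 \<Longrightarrow> prob_space (M n)"
    and groups: "\<And>n. n \<ge> 1 \<Longrightarrow> 1 \<le> q n \<and> q n < p n"
    and log_pos: "\<And>n. n \<ge> 1 \<Longrightarrow> p n - q n \<ge> 2"
    and dims: "\<And>n k. n \<ge> 1 \<Longrightarrow> k \<in> {1..p n} \<Longrightarrow>
          1 \<le> d n k \<and> X n k \<in> carrier_mat n (d n k) \<and> \<beta> n k \<in> carrier_vec (d n k)"
    and col_scale: "\<exists>C. \<forall>n\<ge>1. \<forall>k\<in>{1..p n}. \<forall>j<d n k. (l2 (col (X n k) j))\<^sup>2 \<le> C * real n"
    and sparse: "\<And>n k. n \<ge> 1 \<Longrightarrow> k \<in> {q n + 1..p n} \<Longrightarrow> l2 (\<beta> n k) = 0"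
    and signal: "\<And>n. n \<ge> 1 \<Longrightarrow> \<theta> n > 0"
    and lam_pos: "\<And>n. n \<ge> 1 \<Longrightarrow> lam n > 0"
    and init: "\<And>n. n \<ge> 1 \<Longrightarrow> random_groups (M n) (p n) (d n) (bt n)"
    and estimator: "\<And>n. n \<ge> 1 \<Longrightarrow> random_groups (M n) (p n) (d n) (bh n)"
    and lasso: "\<And>n \<omega>. n \<ge> 1 \<Longrightarrow> \<omega> \<in> space (M n) \<Longrightarrow>
          is_adaptive_group_lasso n (p n) (d n) (X n)
            (response n (p n) (X n) (\<beta> n) (\<lambda>i. err n i \<omega>)) (lam n) (bt n \<omega>) (bh n \<omega>)"
    and C1_sigma: "\<sigma> > 0"
    and C1_indep: "\<And>n. n \<ge> 1 \<Longrightarrow> prob_space.indep_vars (M n) (\<lambda>_. borel) (err n) {..<n}"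
    and C1_normal: "\<And>n i. n \<ge> 1 \<Longrightarrow> i < n \<Longrightarrow>
          distributed (M n) lborel (err n i) (\<lambda>x. ennreal (normal_density 0 \<sigma> x))"
    and C2: "consistent_at_zero M p q \<beta> bt r"
    and C3_1: "(\<lambda>n. sqrt (da n * ln (real (q n))) / (sqrt (real n) * \<theta> n)) \<longlonglongrightarrow> 0"
    and C3_2: "(\<lambda>n. lam n * da n powr (3/2) * real (q n) / (real n * (\<theta> n)\<^sup>2)) \<longlonglongrightarrow> 0"
    and C3_3: "(\<lambda>n. sqrt (real n * dr n * ln (real (p n) - real (q n))) / (lam n * r n)) \<longlonglongrightarrow> 0"
    and C3_4: "(\<lambda>n. da n powr (5/2) * (real (q n))\<^sup>2 / (r n * \<theta> n * sqrt (db n))) \<longlonglongrightarrow> 0"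
    and C4: "\<exists>c>0. \<exists>C. \<forall>\<^sub>F n in sequentially. \<forall>\<mu>.
          eigenvalue (Sigma_mat n (X n) {1..q n}) \<mu> \<longrightarrow> c \<le> \<mu> \<and> \<mu> \<le> C"
  shows "(\<lambda>n. Sigma_Algebra.measure (M n)
            {\<omega>\<in>space (M n). (\<forall>k\<in>{1..q n}. l2 (bh n \<omega> k) \<noteq> 0) \<and>
                             (\<forall>k\<in>{q n + 1..p n}. l2 (bh n \<omega> k) = 0)}) \<longlonglongrightarrow> 1"
proof -
  define P where "P = (\<lambda>n. Sigma_Algebra.measure (M n)
            {\<omega>\<in>space (M n). (\<forall>k\<in>{1..q n}. l2 (bh n \<omega> k) \<noteq> 0) \<and>
                             (\<forall>k\<in>{q n + 1..p n}. l2 (bh n \<omega> k) = 0)})"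
  have da: "1 \<le> da n" and db: "1 \<le> db n" "db n \<le> da n" and dr: "1 \<le> dr n" if n: "n \<ge> 1" for n
  proof -
    have ne: "d n ` {1..p n} \<noteq> {}" using groups[OF n] by auto
    have "d_min (p n) (d n) \<in> d n ` {1..p n}" unfolding d_min_def using ne by (intro Min_in) auto
    moreover have "\<forall>m\<in>d n ` {1..p n}. 1 \<le> m \<and> m \<le> d_max (p n) (d n)"
      using dims[OF n] unfolding d_max_def by auto
    ultimately have "1 \<le> d_min (p n) (d n)" "d_min (p n) (d n) \<le> d_max (p n) (d n)" by auto
    then show "1 \<le> db n" "db n \<le> da n" "1 \<le> da n" by (auto simp: da_def db_def)
    then show "1 \<le> dr n" by (simp add: dr_def d_ratio_def da_def db_def pos_le_divide_eq)
  qed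
  obtain C\<^sub>0 where C\<^sub>0: "\<And>n k j. n \<ge> 1 \<Longrightarrow> k \<in> {1..p n} \<Longrightarrow> j < d n k \<Longrightarrow> (l2 (col (X n k) j))\<^sup>2 \<le> C\<^sub>0 * real n"
    using col_scale by blast
  define C where "C = max C\<^sub>0 1"
  have C: "0 < C" by (simp add: C_def)
  have col: "(l2 (col (X n k) j))\<^sup>2 \<le> C * real n" if "n \<ge> 1" "k \<in> {1..p n}" "j < d n k" for n k j
    by (rule order_trans[OF C\<^sub>0[OF that]]) (simp add: C_def mult_right_mono)
  obtain c C' where c: "0 < c" and eig: "\<forall>\<^sub>F n in sequentially. \<forall>\<mu>.
      eigenvalue (Sigma_mat n (X n) {1..q n}) \<mu> \<longrightarrow> c \<le> \<mu> \<and> \<mu> \<le> C'"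
    using C4 by blast
  have r_lim: "filterlim r at_top sequentially"
    and bdd: "\<And>e. e > 0 \<Longrightarrow> \<exists>K. \<forall>\<^sub>F n in sequentially. Sigma_Algebra.measure (M n)
        {\<omega>\<in>space (M n). \<bar>r n * Max ((\<lambda>k. l2 (bt n \<omega> k)) ` {q n + 1..p n})\<bar> > K} < e"
    using C2 unfolding consistent_at_zero_def bounded_in_prob_def by auto
  obtain \<xi> where \<xi>: "0 < \<xi>" and sep: "\<And>e. e > 0 \<Longrightarrow> \<forall>\<^sub>F n in sequentially. Sigma_Algebra.measure (M n)
      {\<omega>\<in>space (M n). Min ((\<lambda>k. l2 (bt n \<omega> k)) ` {1..q n}) > \<xi> * \<theta> n} > 1 - e"
    using C2 unfolding consistent_at_zero_def \<theta>_def by auto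
  have below: "\<forall>\<^sub>F n in sequentially. f n \<le> \<delta>" if "f \<longlonglongrightarrow> 0" "0 < \<delta>" for f :: "nat \<Rightarrow> real" and \<delta>
    using order_tendstoD(2)[OF that] by (auto elim: eventually_mono)
  have main: "\<forall>\<^sub>F n in sequentially. 1 - 4 * e \<le> P n" if e: "0 < e" for e
  proof -
    obtain K\<^sub>0 where K\<^sub>0: "\<forall>\<^sub>F n in sequentially. Sigma_Algebra.measure (M n)
        {\<omega>\<in>space (M n). \<bar>r n * Max ((\<lambda>k. l2 (bt n \<omega> k)) ` {q n + 1..p n})\<bar> > K\<^sub>0} < e"
      using bdd[OF e] by blast
    define K where "K = max K\<^sub>0 1"
    have K: "0 < K" "K\<^sub>0 \<le> K" by (auto simp: K_def)
    obtain L where L: "1 \<le> L" "sqrt 2 * exp (- ((L - 1) * ln 2)) \<le> e"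
      by (rule union_exp_rate[OF e])
    define \<kappa> where "\<kappa> = c / (16 * \<sigma>\<^sup>2)"
    have \<kappa>: "0 < \<kappa>" using c C1_sigma by (simp add: \<kappa>_def)
    \<comment> \<open>The signal-to-noise ratio \<open>sqrt n * \<theta>\<close> beyond which the Gaussian tail alone is small when \<open>q = 1\<close>.\<close>
    define T where "T = sqrt ((L - 1) * ln 2 / \<kappa>) + 1"
    have T: "0 < T" using L(1) \<kappa> by (simp add: T_def add_nonneg_pos)
    have T_sq: "(L - 1) * ln 2 \<le> \<kappa> * T\<^sup>2"
    proof -
      have "(sqrt ((L - 1) * ln 2 / \<kappa>))\<^sup>2 \<le> T\<^sup>2" using L(1) \<kappa> by (intro power_mono) (auto simp: T_def)
      then show ?thesis using L(1) \<kappa> by (simp add: pos_divide_le_eq mult.commute)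
    qed
    \<comment> \<open>The first bound keeps the bias below \<open>\<theta> / 2\<close>; the second makes the small-ball probability at most \<open>e\<close> when \<open>sqrt n * \<theta> < T\<close>.\<close>
    define \<delta> where "\<delta> = min (\<xi> * c / 2) (e * \<xi> * c * \<sigma> / (T * sqrt C))"
    have \<delta>: "0 < \<delta>" using \<xi> c e C1_sigma T C by (simp add: \<delta>_def)
    have \<delta>_le: "\<delta> \<le> \<xi> * c / 2" "\<delta> \<le> e * \<xi> * c * \<sigma> / (T * sqrt C)"
      unfolding \<delta>_def by (rule min.cobounded1, rule min.cobounded2)
    have e1: "\<forall>\<^sub>F n in sequentially. da n powr (5/2) * (real (q n))\<^sup>2 / (r n * \<theta> n * sqrt (db n)) \<le> \<xi> / (2 * K * sqrt (C / c))"
      by (rule below[OF C3_4]) (use \<xi> K C c in simp)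
    have e2: "\<forall>\<^sub>F n in sequentially. lam n * da n powr (3/2) * real (q n) / (real n * (\<theta> n)\<^sup>2) \<le> \<delta>"
      by (rule below[OF C3_2 \<delta>])
    have e3: "\<forall>\<^sub>F n in sequentially. sqrt (real n * dr n * ln (real (p n) - real (q n))) / (lam n * r n)
        \<le> 1 / (4 * K * \<sigma> * sqrt C * sqrt L)"
      by (rule below[OF C3_3]) (use K C1_sigma C L in simp)
    have e4: "\<forall>\<^sub>F n in sequentially. sqrt (da n * ln (real (q n))) / (sqrt (real n) * \<theta> n) \<le> sqrt (\<kappa> / L)"
      by (rule below[OF C3_1]) (use \<kappa> L in simp)
    have e5: "\<forall>\<^sub>F n in sequentially. 0 < r n"
      using r_lim by (simp add: filterlim_at_top_dense)
    show ?thesis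
      using e1 e2 e3 e4 e5 K\<^sub>0 sep[OF e] eig eventually_ge_at_top[of 1]
    proof eventually_elim
      case (elim n)
      note n = \<open>1 \<le> n\<close>
      interpret prob_space "M n" by (rule prob[OF n])
      have \<theta>: "0 < \<theta> n" using signal[OF n] .
      have lam: "0 < lam n" using lam_pos[OF n] .
      have q: "1 \<le> q n" "q n < p n" "1 \<le> real (q n)" using groups[OF n] by auto
      have r: "0 < r n" by (rule elim(5))
      have n0: "0 < real n" using n by simp
      define \<eta> where "\<eta> = lam n * sqrt (da n) / (\<xi> * \<theta> n) * (sqrt (real (q n)) / (real n * c))"
      note bias = penalty_bias_small[OF lam n0 \<theta> c \<xi> q(3) da[OF n] elim(2), folded \<eta>_def]
      have cross: "lam n * sqrt (da n) / (\<xi> * \<theta> n) * sqrt (real (q n) * C / c) \<le> lam n * r n / (2 * K)"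
        by (rule cross_term_small[OF lam r \<theta> K(1) C c \<xi> q(3) db[OF n] elim(1)])
      have \<eta>: "\<eta> \<le> \<theta> n / 2"
      proof -
        have "\<delta> / (\<xi> * c) \<le> 1 / 2" using \<xi> c \<delta>_le(1) by (simp add: pos_divide_le_eq)
        then have "\<delta> / (\<xi> * c) * \<theta> n \<le> 1 / 2 * \<theta> n" using \<theta> by (intro mult_right_mono) auto
        with bias(1) show ?thesis by argo
      qed
      have \<kappa>_eq: "(\<theta> n)\<^sup>2 * real n * c / (16 * \<sigma>\<^sup>2) = \<kappa> * ((\<theta> n)\<^sup>2 * real n)" by (simp add: \<kappa>_def)
      have signal_bound: "real (q n) * (sqrt 2 * exp (- ((\<theta> n)\<^sup>2 * real n * c / (16 * \<sigma>\<^sup>2)))) \<le> e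
          \<or> q n = 1 \<and> \<eta> * sqrt (real n * C * da n) / \<sigma> \<le> e"
      proof (cases "q n = 1")
        case False
        then have "2 \<le> real (q n)" using q by simp
        from signal_tail_small[OF n0 \<theta> \<kappa> this da[OF n] L(1) elim(4) L(2)]
        show ?thesis unfolding \<kappa>_eq by simp
      next
        case True
        show ?thesis
        proof (cases "T \<le> sqrt (real n) * \<theta> n")
          case big: True
          have "T\<^sup>2 \<le> (sqrt (real n) * \<theta> n)\<^sup>2" using big T by (intro power_mono) auto
          then have "\<kappa> * T\<^sup>2 \<le> \<kappa> * ((\<theta> n)\<^sup>2 * real n)"
            using \<kappa> by (intro mult_left_mono) (auto simp: power_mult_distrib mult.commute)
          with T_sq have "sqrt 2 * exp (- (\<kappa> * ((\<theta> n)\<^sup>2 * real n))) \<le> sqrt 2 * exp (- ((L - 1) * ln 2))"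
            by (intro mult_left_mono) auto
          from order_trans[OF this L(2)] show ?thesis unfolding \<kappa>_eq True by simp
        next
          case False
          have "\<eta> * sqrt (real n * C * da n) = \<eta> * sqrt (da n) * (sqrt C * sqrt (real n))"
            by (simp add: real_sqrt_mult mult_ac)
          also have "\<dots> \<le> \<delta> / (\<xi> * c) * \<theta> n * (sqrt C * sqrt (real n))"
            using bias(2) C by (intro mult_right_mono) auto
          also have "\<dots> = \<delta> / (\<xi> * c) * sqrt C * (sqrt (real n) * \<theta> n)" by simp
          also have "\<dots> \<le> \<delta> / (\<xi> * c) * sqrt C * T"
            using False \<delta> \<xi> c C by (intro mult_left_mono) auto
          also have "\<dots> \<le> (e * \<xi> * c * \<sigma> / (T * sqrt C)) / (\<xi> * c) * sqrt C * T"
            using \<xi> c C T \<delta>_le(2) by (intro mult_right_mono divide_right_mono) auto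
          also have "\<dots> = e * \<sigma>" using \<xi> c C T by simp
          finally show ?thesis using True C1_sigma by (simp add: pos_divide_le_eq)
        qed
      qed
      have "1 - (prob {\<omega>\<in>space (M n). \<bar>r n * Max ((\<lambda>k. l2 (bt n \<omega> k)) ` {q n + 1..p n})\<bar> > K\<^sub>0}
          + (1 - prob {\<omega>\<in>space (M n). Min ((\<lambda>k. l2 (bt n \<omega> k)) ` {1..q n}) > \<xi> * \<theta> n})
          + real (p n - q n) * (sqrt 2 * exp (- ((lam n * r n / (2 * K))\<^sup>2 / (4 * (\<sigma> * sqrt (C * real n))\<^sup>2))))
          + e) \<le> P n"
        unfolding P_def \<theta>_def
      proof (rule selection_probability[where X = "X n" and \<beta> = "\<beta> n" and d = "d n" and lam = "lam n" and c = c and C = C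
            and K = K and err = "err n" and \<sigma> = \<sigma>])
        show "eigenvalue (Sigma_mat n (X n) {1..q n}) \<mu> \<Longrightarrow> c \<le> \<mu>" for \<mu> using elim(8) by blast
        show "lam n * sqrt (real (d_max (p n) (d n))) / (\<xi> * theta_min (q n) (\<beta> n)) * sqrt (real (q n) * C / c)
            \<le> lam n * r n / (2 * K)"
          using cross by (simp add: da_def \<theta>_def)
        show "lam n * sqrt (real (d_max (p n) (d n))) / (\<xi> * theta_min (q n) (\<beta> n)) * (sqrt (real (q n)) / (real n * c))
            \<le> theta_min (q n) (\<beta> n) / 2"
          using \<eta> by (simp add: \<eta>_def da_def \<theta>_def)
        show "real (q n) * (sqrt 2 * exp (- ((theta_min (q n) (\<beta> n))\<^sup>2 * real n * c / (16 * \<sigma>\<^sup>2)))) \<le> e \<or>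
            q n = 1 \<and> lam n * sqrt (real (d_max (p n) (d n))) / (\<xi> * theta_min (q n) (\<beta> n)) * (sqrt (real (q n)) / (real n * c))
              * sqrt (real n * C * real (d_max (p n) (d n))) / \<sigma> \<le> e"
          using signal_bound by (simp only: \<eta>_def da_def \<theta>_def)
        show "0 < theta_min (q n) (\<beta> n)" using \<theta> by (simp add: \<theta>_def)
      qed (use n q c C dims[OF n] col[OF n] sparse[OF n] lam r K \<xi> C1_sigma init[OF n] estimator[OF n]
            lasso[OF n] C1_indep[OF n] C1_normal[OF n] in auto)
      moreover have "real (p n - q n) * (sqrt 2 * exp (- ((lam n * r n / (2 * K))\<^sup>2 / (4 * (\<sigma> * sqrt (C * real n))\<^sup>2)))) \<le> e"
      proof (rule null_tail_small[OF lam r n0 K(1) C C1_sigma _ dr[OF n] L(1) _ L(2)])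
        show "2 \<le> real (p n - q n)" using log_pos[OF n] by simp
        show "sqrt (real n * dr n * ln (real (p n - q n))) / (lam n * r n) \<le> 1 / (4 * K * \<sigma> * sqrt C * sqrt L)"
          using elim(3) q by (simp add: of_nat_diff)
      qed
      ultimately show "1 - 4 * e \<le> P n" using elim(6,7) by linarith
    qed
  qed
  have "P \<longlonglongrightarrow> 1"
  proof (rule tendstoI)
    fix e :: real assume e: "0 < e"
    then have "0 < e / 5" by simp
    from main[OF this] eventually_ge_at_top[of 1] show "\<forall>\<^sub>F n in sequentially. dist (P n) 1 < e"
    proof eventually_elim
      case (elim n)
      have "P n \<le> 1" unfolding P_def using prob[OF elim(2)] by (rule prob_space.prob_le_1)
      then show ?case using elim(1) e by (simp add: dist_real_def)
    qed
  qed
  then show ?thesis by (simp only: P_def)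
qed

end
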